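(* Let $S$ be a factorizable Boolean sublattice all of whose quarks have size at most $2$. The following are equivalent: (a) $S$ is an HFS; (b) for each connected component $C$ of the pairing graph $\mathcal{G}_p(S)$, the Boolean sublattice $\langle E(C)\rangle$ generated by the edges of $C$ (viewed as $2$-element subsets of $\mathbb{N}$) is an HFS; (c) every connected component of $\mathcal{G}_p(S)$ is a cycle of length $3$, a cycle of length $5$, a tree of diameter at most $4$, or a candy graph.
   Context: Let $B_{\mathbb{N}}$ be the set of all finite subsets of $\mathbb{N}=\{1,2,3,\dots\}$, ordered by inclusion. A Boolean sublattice is a subset $S\subseteq B_{\mathbb{N}}$ containing $\emptyset$ and closed under finite unions. For a collection $T$ of finite subsets of $\mathbb{N}$, $\langle T\rangle$ denotes the smallest Boolean sublattice containing $T$. A quark of $S$ is a nonempty $A\in S$ such that no $B\in S$ satisfies $\emptyset\subsetneq B\subsetneq A$; $\mathcal{A}(S)$ is the set of quarks. $S$ is factorizable if every nonempty element is a union of finitely many quarks. For nonempty $X\in S$, a factorization of $X$ in $S$ is a finite set $z\subseteq\mathcal{A}(S)$ with $\bigcup z=X$ and $\bigcup z'\subsetneq X$ for every proper subset $z'\subsetneq z$; $\mathsf{L}(X)$ is the set of sizes of factorizations of $X$. $S$ is an HFS if $\mathsf{L}(X)$ is a singleton for every nonempty $X\in S$. The pairing graph $\mathcal{G}_p(S)$ is the simple graph with vertex set $\mathbb{N}$ and an edge between distinct $a,b$ whenever $\{a,b\}\in\mathcal{A}(S)$ (possibly infinite). The diameter of a tree is the maximum length of a path in it. A candy graph is a connected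 graph of diameter at most $4$ which, for every $k\ge3$, contains a cycle of length $k$ if and only if $k=4$. *)

theory Defs
  imports "HOL-Library.Extended_Nat"
begin

section \<open>Boolean sublattices of the finite subsets of the positive integers\<close>

definition boolean_sublattice :: "nat set set \<Rightarrow> bool" where
  "boolean_sublattice S \<longleftrightarrow>
     S \<subseteq> Fpow {1..} \<and> {} \<in> S \<and> (\<forall>A\<in>S. \<forall>B\<in>S. A \<union> B \<in> S)"

definition generated_sublattice :: "nat set set \<Rightarrow> nat set set" where
  "generated_sublattice T = boolean_sublattice hull T"

definition quarks :: "nat set set \<Rightarrow> nat set set" where
  "quarks S = {A \<in> S. A \<noteq> {} \<and> \<not> (\<exists>B\<in>S. {} \<subset> B \<and> B \<subset> A)}"

definition factorizable :: "nat set set \<Rightarrow> bool" where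
  "factorizable S \<longleftrightarrow>
     (\<forall>X\<in>S. X \<noteq> {} \<longrightarrow> (\<exists>z. finite z \<and> z \<subseteq> quarks S \<and> \<Union>z = X))"

definition factorizations :: "nat set set \<Rightarrow> nat set \<Rightarrow> nat set set set" where
  "factorizations S X =
     {z. finite z \<and> z \<subseteq> quarks S \<and> \<Union>z = X \<and> (\<forall>z'. z' \<subset> z \<longrightarrow> \<Union>z' \<subset> X)}"

definition length_set :: "nat set set \<Rightarrow> nat set \<Rightarrow> nat set" where
  "length_set S X = card ` factorizations S X"

definition HFS :: "nat set set \<Rightarrow> bool" where
  "HFS S \<longleftrightarrow> (\<forall>X\<in>S. X \<noteq> {} \<longrightarrow> is_singleton (length_set S X))"

section \<open>Simple graphs, possibly infinite\<close>

record 'v sgraph =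
  verts :: "'v set"
  edges :: "'v set set"

definition simple_graph :: "'v sgraph \<Rightarrow> bool" where
  "simple_graph G \<longleftrightarrow> (\<forall>e\<in>edges G. e \<subseteq> verts G \<and> card e = 2)"

definition subgraph :: "'v sgraph \<Rightarrow> 'v sgraph \<Rightarrow> bool" where
  "subgraph H G \<longleftrightarrow> simple_graph H \<and> verts H \<subseteq> verts G \<and> edges H \<subseteq> edges G"

definition is_walk :: "'v sgraph \<Rightarrow> 'v list \<Rightarrow> bool" where
  "is_walk G p \<longleftrightarrow>
     p \<noteq> [] \<and> set p \<subseteq> verts G \<and> successively (\<lambda>u v. {u, v} \<in> edges G) p"

definition is_path :: "'v sgraph \<Rightarrow> 'v list \<Rightarrow> bool" where
  "is_path G p \<longleftrightarrow> is_walk G p \<and> distinct p"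

definition connected_graph :: "'v sgraph \<Rightarrow> bool" where
  "connected_graph G \<longleftrightarrow> simple_graph G \<and> verts G \<noteq> {} \<and>
     (\<forall>u\<in>verts G. \<forall>v\<in>verts G. \<exists>p. is_path G p \<and> hd p = u \<and> last p = v)"

definition connected_component_of :: "'v sgraph \<Rightarrow> 'v sgraph \<Rightarrow> bool" where
  "connected_component_of C G \<longleftrightarrow> subgraph C G \<and> connected_graph C \<and>
     (\<forall>H. subgraph H G \<and> connected_graph H \<and> subgraph C H \<longrightarrow> H = C)"

definition cycle_graph :: "nat \<Rightarrow> 'v sgraph \<Rightarrow> bool" where
  "cycle_graph k G \<longleftrightarrow> k \<ge> 3 \<and>
     (\<exists>c. distinct c \<and> length c = k \<and> verts G = set c \<and>
          edges G = {{c ! i, c ! ((i + 1) mod k)} | i. i < k})"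

definition contains_cycle :: "'v sgraph \<Rightarrow> nat \<Rightarrow> bool" where
  "contains_cycle G k \<longleftrightarrow> (\<exists>H. subgraph H G \<and> cycle_graph k H)"

definition is_tree :: "'v sgraph \<Rightarrow> bool" where
  "is_tree G \<longleftrightarrow> connected_graph G \<and> \<not> (\<exists>k. contains_cycle G k)"

text \<open>
  The diameter is the maximum length (number of edges) of a path. This is not the largest
  distance between two vertices: the two notions agree on trees, but not on candy graphs.
  It is infinite if paths are arbitrarily long.
\<close>

definition diameter :: "'v sgraph \<Rightarrow> enat" where
  "diameter G = (SUP p \<in> {p. is_path G p}. enat (length p - 1))"

definition candy_graph :: "'v sgraph \<Rightarrow> bool" where
  "candy_graph G \<longleftrightarrow> connected_graph G \<and> diameter G \<le> 4 \<and>
     (\<forall>k\<ge>3. contains_cycle G k \<longleftrightarrow> k = 4)"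

definition pairing_graph :: "nat set set \<Rightarrow> nat sgraph" where
  "pairing_graph S =
     \<lparr>verts = {1..}, edges = {{a, b} | a b. a \<noteq> b \<and> {a, b} \<in> quarks S}\<rparr>"

end

theory Submission
  imports Defs
begin

text \<open>
  Everything reduces to a statement about families of sets: all irredundant finite subfamilies with
  a given union have the same size. Irredundance and size decompose along the connected components
  of the pairing graph; a singleton quark is isolated in it, since no other quark can contain it.

  In one component, a path on six vertices has edge covers of sizes 3 and 4, and a triangle with a
  pendant edge has edge covers of sizes 2 and 3. Excluding these two subgraphs leaves exactly the
  listed shapes. Conversely, in a cycle of length 3 or 5 double counting pins the size of an
  irredundant cover of \<open>n\<close> vertices between \<open>n / 2\<close> and \<open>2 n / 3\<close>; a tree of diameter at most 4 has a
  centre such that every edge avoiding it ends in a leaf, so only the edges at the centre can vary;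
  and a candy graph has two hubs such that every edge contains exactly one of them.
\<close>

section \<open>Irredundant families and factorizations\<close>

text \<open>Six vertices are the threshold throughout. For \<open>n\<close> at most 5 the interval
  from \<open>n / 2\<close> to \<open>2 n / 3\<close> contains at most one integer, so the double
  count settles the size; for \<open>n = 6\<close> it contains 3 and 4, exactly the two cover sizes
  of the path on six vertices. That path also lies inside every cycle of length at least 6, so
  forbidding it bounds the cycle lengths as well as the diameter. A triangle cannot be left without
  acquiring a pendant edge, and a pentagon cannot be left without producing six vertices in a row,
  while a chord of it closes a triangle. So apart from these two graphs only cycles of length 4
  remain, and their presence or absence separates candy graphs from trees. Trees and candy graphs
  may be infinite, so there the sizes are read off a finite cover and its union, never off the whole
  component.\<close>

definition irredundant :: "'a set set \<Rightarrow> bool" where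
  "irredundant z \<longleftrightarrow> (\<forall>e\<in>z. \<exists>x\<in>e. \<forall>f\<in>z. x \<in> f \<longrightarrow> f = e)"

text \<open>Pairs of finite irredundant families with equal union stand in for two factorizations of
  one element; no lattice occurs. The condition is inherited by subfamilies of \<open>Q\<close>, so
  it descends to the edges of a component.\<close>

definition half_factorial :: "'a set set \<Rightarrow> bool" where
  "half_factorial Q \<longleftrightarrow>
     (\<forall>z w. finite z \<and> finite w \<and> z \<subseteq> Q \<and> w \<subseteq> Q \<and> irredundant z \<and> irredundant w \<and> \<Union>z = \<Union>w
        \<longrightarrow> card z = card w)"

lemma half_factorialD:
  assumes "half_factorial Q" "finite z" "finite w" "z \<subseteq> Q" "w \<subseteq> Q"
    "irredundant z" "irredundant w" "\<Union>z = \<Union>w"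
  shows "card z = card w"
  using assms unfolding half_factorial_def by blast

lemma half_factorial_subset: "half_factorial Q \<Longrightarrow> R \<subseteq> Q \<Longrightarrow> half_factorial R"
  unfolding half_factorial_def by (meson order_trans)

lemma irredundantE:
  assumes "irredundant z" "e \<in> z"
  obtains x where "x \<in> e" "\<forall>f\<in>z. x \<in> f \<longrightarrow> f = e"
  using assms unfolding irredundant_def by blast

lemma irredundant_subset: "irredundant z \<Longrightarrow> w \<subseteq> z \<Longrightarrow> irredundant w"
  unfolding irredundant_def by (meson subsetD)

text \<open>The families \<open>z - {e}\<close> already test for redundancy: what such a family
  loses is exactly the set of points owned by \<open>e\<close> alone. The form with private points
  is the one that can be counted and restricted; the form with proper subfamilies is the one in the
  definition of a factorization.\<close>

lemma irredundant_iff_proper_subset: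
  "irredundant z \<longleftrightarrow> (\<forall>w. w \<subset> z \<longrightarrow> \<Union>w \<subset> \<Union>z)"
proof
  assume irr: "irredundant z"
  show "\<forall>w. w \<subset> z \<longrightarrow> \<Union>w \<subset> \<Union>z"
  proof (intro allI impI)
    fix w assume w: "w \<subset> z"
    then obtain e where e: "e \<in> z" "e \<notin> w" by blast
    obtain x where "x \<in> e" "\<forall>f\<in>z. x \<in> f \<longrightarrow> f = e" by (rule irredundantE[OF irr e(1)])
    with e w have "x \<in> \<Union>z" "x \<notin> \<Union>w" by blast+
    with w show "\<Union>w \<subset> \<Union>z" by blast
  qed
next
  assume *: "\<forall>w. w \<subset> z \<longrightarrow> \<Union>w \<subset> \<Union>z"
  show "irredundant z" unfolding irredundant_def
  proof
    fix e assume "e \<in> z"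
    then have "z - {e} \<subset> z" by blast
    with * have "\<Union>(z - {e}) \<subset> \<Union>z" by (elim allE impE)
    then show "\<exists>x\<in>e. \<forall>f\<in>z. x \<in> f \<longrightarrow> f = e" by blast
  qed
qed

text \<open>Take a subfamily of least size with the same union: a proper subfamily with that union
  would be smaller. This turns the union of quarks given by factorizability into an actual
  factorization.\<close>

lemma irredundant_subcover_exists:
  assumes "finite z"
  shows "\<exists>w\<subseteq>z. irredundant w \<and> \<Union>w = \<Union>z"
proof -
  let ?P = "\<lambda>w. w \<subseteq> z \<and> \<Union>w = \<Union>z"
  have "?P z" by simp
  then obtain w where w: "?P w" and min: "\<And>y. ?P y \<Longrightarrow> card w \<le> card y"
    using ex_has_least_nat[of ?P z card] by auto
  have "\<Union>y \<subset> \<Union>w" if "y \<subset> w" for y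
  proof -
    have "card y < card w" using that w assms by (meson finite_subset psubset_card_mono)
    with min w that show ?thesis by (metis Union_mono leD order_trans psubset_imp_subset psubsetI)
  qed
  with w show ?thesis unfolding irredundant_iff_proper_subset by blast
qed

text \<open>Used to pin down a whole cover: once some of its members already cover everything, there
  are no others.\<close>

lemma irredundant_cover_subset:
  assumes "irredundant z" "w \<subseteq> z" "\<Union>z \<subseteq> \<Union>w"
  shows "z = w"
  using assms unfolding irredundant_iff_proper_subset by blast

section \<open>Sublattices and their quarks as families of sets\<close>

lemma Union_finite_in_sublattice:
  assumes "boolean_sublattice S" "finite z" "z \<subseteq> S"
  shows "\<Union>z \<in> S"
  using assms(2,3)
proof (induction z rule: finite_induct)
  case empty
  then show ?case using assms(1) by (simp add: boolean_sublattice_def)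
next
  case (insert A z)
  then show ?case using assms(1) by (simp add: boolean_sublattice_def)
qed

text \<open>Factorizations are the finite irredundant families of quarks, and any union of finitely
  many quarks lies in \<open>S\<close>, so letting \<open>X\<close> run over \<open>S\<close> or
  over such unions is the same.\<close>

lemma HFS_iff_half_factorial_quarks:
  assumes S: "boolean_sublattice S" "factorizable S"
  shows "HFS S \<longleftrightarrow> half_factorial (quarks S)"
proof -
  have fac: "z \<in> factorizations S X \<longleftrightarrow>
      finite z \<and> z \<subseteq> quarks S \<and> irredundant z \<and> \<Union>z = X" for z X
    unfolding factorizations_def irredundant_iff_proper_subset by auto
  show ?thesis
  proof
    assume hfs: "HFS S"
    show "half_factorial (quarks S)" unfolding half_factorial_def
    proof (intro allI impI, elim conjE)
      fix z w assume z: "finite z" "z \<subseteq> quarks S" "irredundant z"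
        and w: "finite w" "w \<subseteq> quarks S" "irredundant w" and eq: "\<Union>z = \<Union>w"
      show "card z = card w"
      \<comment> \<open>\<open>HFS\<close> says nothing about the empty set; there both families are
        empty because no quark is.\<close>
      proof (cases "\<Union>z = {}")
        case True
        have "{} \<notin> quarks S" by (simp add: quarks_def)
        moreover have "\<Union>w = {}" using True eq by simp
        ultimately have "z = {}" "w = {}"
          using z(2) w(2) True unfolding Union_empty_conv by (metis ex_in_conv subsetD)+
        then show ?thesis by simp
      next
        case False
        have "\<Union>z \<in> S"
          using Union_finite_in_sublattice[OF S(1) z(1)] z(2) unfolding quarks_def by blast
        with False hfs have "is_singleton (length_set S (\<Union>z))" unfolding HFS_def by blast
        moreover have "card z \<in> length_set S (\<Union>z)" "card w \<in> length_set S (\<Union>z)"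
          using z w eq fac unfolding length_set_def by auto
        ultimately show ?thesis by (auto simp: is_singleton_def)
      qed
    qed
  next
    assume hf: "half_factorial (quarks S)"
    show "HFS S" unfolding HFS_def
    proof (intro ballI impI)
      fix X assume X: "X \<in> S" "X \<noteq> {}"
      with S(2) obtain y where "finite y" "y \<subseteq> quarks S" "\<Union>y = X"
        unfolding factorizable_def by blast
      then obtain z where z: "z \<in> factorizations S X"
        using irredundant_subcover_exists[of y] fac by (metis finite_subset order_trans)
      have "card w = card z" if "w \<in> factorizations S X" for w
        using that z hf half_factorialD fac by metis
      then have "length_set S X = (\<lambda>_. card z) ` factorizations S X"
        unfolding length_set_def by (intro image_cong refl)
      also have "\<dots> = {card z}" using z by (rule image_constant)
      finally have "length_set S X = {card z}" .
      then show "is_singleton (length_set S X)" by simp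
    qed
  qed
qed

lemma boolean_sublattice_finite_unions:
  assumes "T \<subseteq> Fpow {1..}"
  shows "boolean_sublattice {\<Union>z | z. finite z \<and> z \<subseteq> T}" (is "boolean_sublattice ?U")
proof -
  have "?U \<subseteq> Fpow {1..}"
    using assms unfolding Fpow_def by auto
  moreover have "{} \<in> ?U" by blast
  moreover have "A \<union> B \<in> ?U" if "A \<in> ?U" "B \<in> ?U" for A B
  proof -
    from that obtain z w where "finite z" "z \<subseteq> T" "A = \<Union>z" "finite w" "w \<subseteq> T" "B = \<Union>w" by blast
    then have "A \<union> B = \<Union>(z \<union> w)" "finite (z \<union> w)" "z \<union> w \<subseteq> T" by auto
    then show ?thesis by blast
  qed
  ultimately show ?thesis unfolding boolean_sublattice_def by (intro conjI ballI)
qed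

lemma generated_sublattice_eq:
  assumes "T \<subseteq> Fpow {1..}"
  shows "generated_sublattice T = {\<Union>z | z. finite z \<and> z \<subseteq> T}" (is "_ = ?U")
proof -
  have "T \<subseteq> ?U"
  proof
    fix A assume "A \<in> T"
    then have "A = \<Union>{A} \<and> finite {A} \<and> {A} \<subseteq> T" by simp
    then show "A \<in> ?U" by blast
  qed
  moreover have "?U \<subseteq> S" if "boolean_sublattice S" "T \<subseteq> S" for S
    using that Union_finite_in_sublattice[OF that(1)] by blast
  ultimately show ?thesis unfolding generated_sublattice_def
    using boolean_sublattice_finite_unions[OF assms] by (intro hull_unique) auto
qed

text \<open>Sets of the same finite size are pairwise incomparable, and every nonempty element of
  the generated sublattice contains some member of \<open>E\<close>; so its quarks are exactly
  \<open>E\<close>, and it is factorizable by construction.\<close>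

lemma HFS_generated_sublattice_iff:
  assumes "E \<subseteq> Fpow {1..}" "\<forall>e\<in>E. card e = 2"
  shows "HFS (generated_sublattice E) \<longleftrightarrow> half_factorial E"
proof -
  let ?S = "generated_sublattice E"
  note eq = generated_sublattice_eq[OF assms(1)]
  have incomparable: "e = f" if "e \<in> E" "f \<in> E" "e \<subseteq> f" for e f
    using that assms(2) by (metis card_subset_eq card.infinite zero_neq_numeral)
  have mem: "e \<in> ?S" if "e \<in> E" for e
  proof -
    have "e = \<Union>{e} \<and> finite {e} \<and> {e} \<subseteq> E" using that by simp
    then show ?thesis unfolding eq by blast
  qed
  have ne: "e \<noteq> {}" if "e \<in> E" for e using that assms(2) by fastforce
  have below: "\<exists>e\<in>E. e \<subseteq> A" if "A \<in> ?S" "A \<noteq> {}" for A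
    using that unfolding eq by blast
  have q: "quarks ?S = E"
  proof
    show "quarks ?S \<subseteq> E"
    proof
      fix A assume A: "A \<in> quarks ?S"
      then obtain e where e: "e \<in> E" "e \<subseteq> A" using below[of A] by (auto simp: quarks_def)
      with A mem[of e] ne[of e] have "e = A" by (auto simp: quarks_def)
      with e show "A \<in> E" by simp
    qed
    show "E \<subseteq> quarks ?S"
    proof
      fix e assume e: "e \<in> E"
      have "\<not> B \<subset> e" if "B \<in> ?S" "{} \<subset> B" for B
        using below[of B] that incomparable e by blast
      then show "e \<in> quarks ?S" using mem[OF e] ne[OF e] by (auto simp: quarks_def)
    qed
  qed
  have "boolean_sublattice ?S"
    using boolean_sublattice_finite_unions[OF assms(1)] unfolding eq .
  moreover have "factorizable ?S"
    unfolding factorizable_def q unfolding eq by blast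
  ultimately show ?thesis using HFS_iff_half_factorial_quarks q by metis
qed

section \<open>Half-factorial families\<close>

lemma card_2_other_element:
  assumes "card e = 2" "h \<in> e"
  obtains x where "e = {h, x}" "x \<noteq> h"
  using assms by (auto simp: card_2_iff)

text \<open>\<open>k\<close> labels the points, and the members of \<open>z\<close> labelled
  \<open>c\<close> cover exactly the points of \<open>\<Union>z\<close> labelled \<open>c\<close>.
  That set depends on the union only, so two families with the same union can be compared label by
  label and the sizes added.\<close>

lemma half_factorial_partition:
  assumes const: "\<And>e x y. e \<in> Q \<Longrightarrow> x \<in> e \<Longrightarrow> y \<in> e \<Longrightarrow> k x = k y"
    and ne: "{} \<notin> Q"
    and parts: "\<And>c. half_factorial {e \<in> Q. k ` e = {c}}"
  shows "half_factorial Q"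
  unfolding half_factorial_def
proof (intro allI impI, elim conjE)
  fix z w assume z: "finite z" "z \<subseteq> Q" "irredundant z"
    and w: "finite w" "w \<subseteq> Q" "irredundant w" and eq: "\<Union>z = \<Union>w"
  let ?part = "\<lambda>z c. {e \<in> z. k ` e = {c}}"
  have cls: "k ` e = {c} \<longleftrightarrow> c \<in> k ` e" if "e \<in> Q" for e c
    using const[OF that] by blast
  have union: "\<Union>(?part z c) = {x \<in> \<Union>z. k x = c}" if "z \<subseteq> Q" for z c
    using that cls by blast
  have decomp: "card z = (\<Sum>c\<in>k ` \<Union>z. card (?part z c))" if "finite z" "z \<subseteq> Q" for z
  proof -
    \<comment> \<open>Members of \<open>Q\<close> may be infinite sets; finiteness comes from each
      contributing a single label.\<close>
    have fin: "finite (k ` \<Union>z)"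
    proof -
      have "finite (k ` e)" if "e \<in> z" for e
      proof -
        have "e \<in> Q" using that \<open>z \<subseteq> Q\<close> by blast
        then obtain x where "x \<in> e" using ne by (cases "e = {}") auto
        then have "k ` e = {k x}" using cls[OF \<open>e \<in> Q\<close>] by simp
        then show ?thesis by simp
      qed
      then show ?thesis using \<open>finite z\<close> by (simp add: image_Union)
    qed
    have "z = (\<Union>c\<in>k ` \<Union>z. ?part z c)"
    proof
      show "z \<subseteq> (\<Union>c\<in>k ` \<Union>z. ?part z c)"
      proof
        fix e assume e: "e \<in> z"
        then obtain x where "x \<in> e" using \<open>z \<subseteq> Q\<close> ne by (cases "e = {}") auto
        then have "e \<in> ?part z (k x)" "k x \<in> k ` \<Union>z"
          using e that(2) cls[of e "k x"] by auto
        then show "e \<in> (\<Union>c\<in>k ` \<Union>z. ?part z c)" by (rule UN_I[rotated])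
      qed
    qed blast
    then have "card z = card (\<Union>c\<in>k ` \<Union>z. ?part z c)" by simp
    also have "\<dots> = (\<Sum>c\<in>k ` \<Union>z. card (?part z c))"
      using fin \<open>finite z\<close> by (intro card_UN_disjoint) auto
    finally show ?thesis .
  qed
  have "card (?part z c) = card (?part w c)" for c
  proof (rule half_factorialD[OF parts[of c]])
    show "\<Union>(?part z c) = \<Union>(?part w c)" using union[OF z(2)] union[OF w(2)] eq by simp
  qed (use z w in \<open>auto intro: irredundant_subset\<close>)
  then show "card z = card w" using decomp[OF z(1,2)] decomp[OF w(1,2)] eq by simp
qed

text \<open>An edge avoiding \<open>c\<close> has an end that no other edge of \<open>E\<close>
  covers, so it belongs to both families or to neither. The remaining edges all pass through
  \<open>c\<close>, and each is determined by its other end.\<close>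

lemma half_factorial_centre:
  assumes two: "\<forall>e\<in>E. card e = 2"
    and pendant: "\<And>e. e \<in> E \<Longrightarrow> c \<notin> e \<Longrightarrow> \<exists>x\<in>e. \<forall>f\<in>E. x \<in> f \<longrightarrow> f = e"
  shows "half_factorial E"
  unfolding half_factorial_def
proof (intro allI impI, elim conjE)
  fix z w assume z: "finite z" "z \<subseteq> E" "irredundant z"
    and w: "finite w" "w \<subseteq> E" "irredundant w" and eq: "\<Union>z = \<Union>w"
  define F where "F = {e \<in> z. c \<notin> e}"
  have sub: "{e \<in> z. c \<notin> e} \<subseteq> w" if "z \<subseteq> E" "w \<subseteq> E" "\<Union>z = \<Union>w" for z w
  proof
    fix e assume e: "e \<in> {e \<in> z. c \<notin> e}"
    with \<open>z \<subseteq> E\<close> have "e \<in> E" "c \<notin> e" by auto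
    then obtain x where x: "x \<in> e" "\<forall>f\<in>E. x \<in> f \<longrightarrow> f = e" using pendant by blast
    with e have "x \<in> \<Union>w" unfolding that(3)[symmetric] by blast
    then obtain f where "f \<in> w" "x \<in> f" by blast
    moreover from this have "f = e" using bspec[OF x(2), of f] that(2) by blast
    ultimately show "e \<in> w" by simp
  qed
  have F': "F = {e \<in> w. c \<notin> e}"
    using sub[OF z(2) w(2) eq] sub[OF w(2) z(2) eq[symmetric]] unfolding F_def by blast
  have other: "\<exists>b. e = {c, b}" if "e \<in> E" "c \<in> e" for e
    using that two by (metis card_2_other_element)
  define Y where "Y = \<Union>z - \<Union>F"
  have c_F: "c \<notin> \<Union>F" unfolding F_def by blast
  \<comment> \<open>The vertices left uncovered by \<open>F\<close> decide the rest: each one other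
    than \<open>c\<close> forces its edge to \<open>c\<close>. The maximum with 1 is for the case
    \<open>Y = {c}\<close>, where a single edge is spent on \<open>c\<close> alone; which edge it is
    may differ between the families, its contribution to the size does not.\<close>
  have size: "card v = card F + (if c \<in> Y then max 1 (card ((\<lambda>b. {c, b}) ` (Y - {c}))) else 0)"
    if v: "finite v" "v \<subseteq> E" "irredundant v" "\<Union>v = \<Union>z" and Fv: "F = {e \<in> v. c \<notin> e}" for v
  proof (cases "c \<in> Y")
    case False
    then have "c \<notin> \<Union>v" using c_F unfolding v(4) Y_def by blast
    then have "v = F" unfolding Fv by blast
    with False show ?thesis by simp
  next
    case True
    define R where "R = (\<lambda>b. {c, b}) ` (Y - {c})"
    have R: "R \<subseteq> v"
    proof
      fix e assume "e \<in> R"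
      then obtain b where b: "b \<in> Y" "b \<noteq> c" "e = {c, b}" unfolding R_def by blast
      then have "b \<in> \<Union>v" "b \<notin> \<Union>F" unfolding v(4) Y_def by auto
      then obtain f where f: "f \<in> v" "b \<in> f" "f \<notin> F" by blast
      then have "c \<in> f" unfolding Fv by blast
      with f v(2) other[of f] b show "e \<in> v" by auto
    qed
    have "finite F" "finite R" using R v(1) Fv by (auto intro: finite_subset[OF R])
    have disj: "F \<inter> R = {}" unfolding F_def R_def by blast
    show ?thesis
    proof (cases "Y = {c}")
      case False
      with True have "c \<in> \<Union>R" unfolding R_def by blast
      then have "\<Union>v \<subseteq> \<Union>(F \<union> R)" unfolding v(4) Y_def R_def by blast
      moreover have "F \<union> R \<subseteq> v" using R Fv by blast
      ultimately have "v = F \<union> R" using irredundant_cover_subset v(3) by metis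
      moreover have "card R \<ge> 1" using \<open>finite R\<close> \<open>c \<in> \<Union>R\<close> by (auto simp: Suc_le_eq card_gt_0_iff)
      ultimately show ?thesis
        using True disj \<open>finite F\<close> \<open>finite R\<close> unfolding R_def by (simp add: card_Un_disjoint)
    next
      case Y: True
      have "c \<in> \<Union>v" using True unfolding v(4) Y_def by blast
      then obtain e where e: "e \<in> v" "c \<in> e" by blast
      have "\<Union>v \<subseteq> \<Union>(insert e F)" using Y e unfolding v(4) Y_def by blast
      moreover have "insert e F \<subseteq> v" using e Fv by blast
      ultimately have "v = insert e F" using irredundant_cover_subset v(3) by metis
      moreover have "e \<notin> F" using e unfolding F_def by blast
      ultimately show ?thesis using Y \<open>finite F\<close> by simp
    qed
  qed
  show "card z = card w"
    using size[OF z(1-3) refl F_def] size[OF w eq[symmetric] F'] by simp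
qed

text \<open>If both hubs are covered, the size is \<open>max 2 (n - 2)\<close> for \<open>n\<close>
  covered vertices. Normally each edge of the family has its own non-hub end, which gives
  \<open>n - 2\<close>. Two edges share that end only if the family joins some \<open>x\<close> to
  both hubs; irredundance then leaves just these two edges, with \<open>n = 3\<close> and size
  2.\<close>

lemma half_factorial_hub_pair:
  assumes two: "\<forall>e\<in>E. card e = 2"
    and hub: "\<forall>e\<in>E. (a \<in> e) \<noteq> (b \<in> e)"
  shows "half_factorial E"
  unfolding half_factorial_def
proof (intro allI impI, elim conjE)
  fix z w assume z: "finite z" "z \<subseteq> E" "irredundant z"
    and w: "finite w" "w \<subseteq> E" "irredundant w" and eq: "\<Union>z = \<Union>w"
  have finE: "finite e" if "e \<in> E" for e using two that by (metis card.infinite zero_neq_numeral)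
  have other: "\<exists>x. e = {h, x} \<and> x \<noteq> a \<and> x \<noteq> b" if "e \<in> E" "h \<in> e" "h = a \<or> h = b" for e h
  proof -
    from that two have "card e = 2" by blast
    then obtain x where x: "e = {h, x}" "x \<noteq> h" using \<open>h \<in> e\<close> by (rule card_2_other_element)
    have "(a \<in> e) \<noteq> (b \<in> e)" using hub \<open>e \<in> E\<close> by blast
    with x that(3) show ?thesis by blast
  qed
  \<comment> \<open>When one hub is missed, all edges meet at the other, so a non-hub vertex
    determines its edge and equal unions force equal families.\<close>
  have one_hub: "z \<subseteq> w" if z: "z \<subseteq> E" and w: "w \<subseteq> E" and eq: "\<Union>z = \<Union>w"
    and miss: "a \<notin> \<Union>z \<or> b \<notin> \<Union>z" for z w
  proof
    fix e assume e: "e \<in> z"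
    with z hub obtain h where h: "h \<in> e" "h = a \<or> h = b" by blast
    with other[of e h] e z obtain x where x: "e = {h, x}" "x \<noteq> a" "x \<noteq> b" by blast
    with e have "x \<in> \<Union>w" unfolding eq[symmetric] by blast
    then obtain f where f: "f \<in> w" "x \<in> f" by blast
    have "f \<subseteq> \<Union>z" using f unfolding eq by blast
    moreover have "e \<subseteq> \<Union>z" using e by blast
    moreover have "(a \<in> e) \<noteq> (b \<in> e)" "(a \<in> f) \<noteq> (b \<in> f)" using hub e f z w by blast+
    ultimately have "h \<in> f" using miss h by (metis subsetD)
    with other[of f h] f w h x show "e \<in> w" by auto
  qed
  show "card z = card w"
  proof (cases "a \<in> \<Union>z \<and> b \<in> \<Union>z")
    case False
    then have miss: "a \<notin> \<Union>z \<or> b \<notin> \<Union>z" by blast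
    have "z \<subseteq> w" using z(2) w(2) eq miss by (rule one_hub)
    moreover have "w \<subseteq> z" using w(2) z(2) eq[symmetric] miss[unfolded eq] by (rule one_hub)
    ultimately show ?thesis by simp
  next
    case True
    then obtain e where "e \<in> z" "a \<in> e" by blast
    then have "a \<noteq> b" using hub z(2) by blast
    have size: "card v = max 2 (card (\<Union>z) - 2)"
      if v: "finite v" "v \<subseteq> E" "irredundant v" "\<Union>v = \<Union>z" for v
    proof -
      have fin: "finite (\<Union>z)" using v finE by (metis finite_Union subsetD)
      obtain ea eb where e: "ea \<in> v" "a \<in> ea" "eb \<in> v" "b \<in> eb" using True unfolding v(4)[symmetric] by blast
      then have "ea \<noteq> eb" using hub v(2) by blast
      have "card {ea, eb} \<le> card v" using e v(1) by (intro card_mono) auto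
      then have ge: "card v \<ge> 2" using \<open>ea \<noteq> eb\<close> by simp
      show ?thesis
      proof (cases "\<exists>x. {a, x} \<in> v \<and> {b, x} \<in> v")
        case True
        then obtain x where x: "{a, x} \<in> v" "{b, x} \<in> v" by blast
        have x': "x \<noteq> a" "x \<noteq> b" using hub[rule_format, of "{a, x}"] hub[rule_format, of "{b, x}"] x v(2)
          by auto
        have ne: "{a, x} \<noteq> {b, x}" using \<open>a \<noteq> b\<close> x' by (simp add: doubleton_eq_iff)
        \<comment> \<open>The shared end \<open>x\<close> is private to neither edge, so
          \<open>a\<close> and \<open>b\<close> must be the private points; every edge contains one
          of them, hence there is no third edge.\<close>
        have priv: "\<forall>f\<in>v. a \<in> f \<longrightarrow> f = {a, x}" "\<forall>f\<in>v. b \<in> f \<longrightarrow> f = {b, x}"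
        proof -
          obtain y where y: "y \<in> {a, x}" "\<forall>f\<in>v. y \<in> f \<longrightarrow> f = {a, x}"
            by (rule irredundantE[OF v(3) x(1)])
          then have "y \<noteq> x" using bspec[OF y(2) x(2)] ne by auto
          with y show "\<forall>f\<in>v. a \<in> f \<longrightarrow> f = {a, x}" by simp
        next
          obtain y where y: "y \<in> {b, x}" "\<forall>f\<in>v. y \<in> f \<longrightarrow> f = {b, x}"
            by (rule irredundantE[OF v(3) x(2)])
          then have "y \<noteq> x" using bspec[OF y(2) x(1)] ne by auto
          with y show "\<forall>f\<in>v. b \<in> f \<longrightarrow> f = {b, x}" by simp
        qed
        have "a \<in> f \<or> b \<in> f" if "f \<in> v" for f using hub v(2) that by blast
        then have "f = {a, x} \<or> f = {b, x}" if "f \<in> v" for f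
          using priv[rule_format, OF that] that by blast
        with x have v_eq: "v = {{a, x}, {b, x}}" by blast
        have "\<Union>v = {a, b, x}" unfolding v_eq by blast
        then have "card (\<Union>z) = 3" using x' \<open>a \<noteq> b\<close> unfolding v(4) by simp
        moreover have "card v = 2" using ne unfolding v_eq by simp
        ultimately show ?thesis by simp
      next
        case False
        have "\<exists>x. x \<noteq> a \<and> x \<noteq> b \<and> (e = {a, x} \<or> e = {b, x})" if "e \<in> v" for e
        proof -
          have "e \<in> E" using that v(2) by blast
          then show ?thesis using hub other[of e a] other[of e b] by blast
        qed
        \<comment> \<open>\<open>g\<close> picks the non-hub end. It is injective on
          \<open>v\<close> because two edges with a common non-hub end would be the pair excluded in
          this case.\<close>
        then obtain g where g': "\<And>e. e \<in> v \<Longrightarrow> g e \<noteq> a \<and> g e \<noteq> b \<and> (e = {a, g e} \<or> e = {b, g e})"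
          by metis
        have g: "x = g e" if "e \<in> v" "x \<in> e" "x \<noteq> a" "x \<noteq> b" for e x
          using g'[OF that(1)] that(2-4) by (metis empty_iff insertE)
        have "bij_betw g v (\<Union>z - {a, b})"
        proof (rule bij_betwI')
          fix e f assume "e \<in> v" "f \<in> v"
          then show "(g e = g f) = (e = f)" using g'[of e] g'[of f] False by metis
        next
          fix e assume "e \<in> v"
          then show "g e \<in> \<Union>z - {a, b}" using g'[of e] unfolding v(4)[symmetric] by auto
        next
          fix x assume "x \<in> \<Union>z - {a, b}"
          then have "x \<in> \<Union>v" "x \<noteq> a" "x \<noteq> b" unfolding v(4) by auto
          then show "\<exists>e\<in>v. x = g e" using g by blast
        qed
        then have "card v = card (\<Union>z - {a, b})" by (rule bij_betw_same_card)
        also have "\<dots> = card (\<Union>z) - 2" using True \<open>a \<noteq> b\<close> fin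
          by (subst card_Diff_subset) auto
        finally show ?thesis using ge by simp
      qed
    qed
    show ?thesis using size[OF z refl] size[OF w eq[symmetric]] by simp
  qed
qed

text \<open>Double counting of incidences gives \<open>2 |z| + |A| = 2 n\<close>, where
  \<open>n\<close> is the size of the union and \<open>A\<close> the set of its points of degree 1.
  The first bound is then \<open>|A| <= n\<close>, the second is \<open>|z| <= |A|\<close>, which
  holds since private points of distinct edges are distinct.\<close>

lemma irredundant_card_bounds:
  assumes z: "finite z" "irredundant z" "\<forall>e\<in>z. card e = 2"
    and deg: "\<And>x. card {e \<in> z. x \<in> e} \<le> 2"
  shows "card (\<Union>z) \<le> 2 * card z" "3 * card z \<le> 2 * card (\<Union>z)"
proof -
  let ?d = "\<lambda>x. card {e \<in> z. x \<in> e}"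
  \<comment> \<open>\<open>A\<close> is the set of elements of degree 1; each member of \<open>z\<close> owns one of them, all others have degree 2.\<close>
  define A where "A = {x \<in> \<Union>z. ?d x = 1}"
  have finz: "finite e" if "e \<in> z" for e using z(3) that by (metis card.infinite zero_neq_numeral)
  then have fin: "finite (\<Union>z)" using z(1) by blast
  have "{x \<in> \<Union>z. x \<in> e} = e" if "e \<in> z" for e using that by blast
  then have "\<forall>e\<in>z. card {x \<in> \<Union>z. x \<in> e} = 2" using z(3) by simp
  then have sum: "2 * card z = (\<Sum>x\<in>\<Union>z. ?d x)"
    using sum_multicount_gen[OF fin z(1), of "(\<in>)" "\<lambda>_. 2"] by simp
  have d: "?d x + (if x \<in> A then 1 else 0) = 2" if "x \<in> \<Union>z" for x
  proof -
    have "?d x > 0" using that z(1) by (auto simp: card_gt_0_iff)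
    then show ?thesis using deg[of x] that unfolding A_def by auto
  qed
  have "(\<Sum>x\<in>\<Union>z. ?d x) + card A = (\<Sum>x\<in>\<Union>z. ?d x + (if x \<in> A then 1 else 0))"
  proof -
    have "A = \<Union>z \<inter> A" unfolding A_def by blast
    then have "card A = (\<Sum>x\<in>\<Union>z. if x \<in> A then 1 else 0)"
      using sum.inter_restrict[OF fin, of "\<lambda>_. 1::nat" A] by simp
    then show ?thesis by (simp add: sum.distrib)
  qed
  also have "\<dots> = 2 * card (\<Union>z)" using d by simp
  finally have A: "2 * card z + card A = 2 * card (\<Union>z)" using sum by simp
  have "card A \<le> card (\<Union>z)" using fin unfolding A_def by (intro card_mono) auto
  with A show "card (\<Union>z) \<le> 2 * card z" by simp
  obtain p where p: "\<And>e. e \<in> z \<Longrightarrow> p e \<in> e \<and> (\<forall>f\<in>z. p e \<in> f \<longrightarrow> f = e)"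
    using z(2) unfolding irredundant_def by metis
  have "card z \<le> card A"
  proof (rule card_inj_on_le)
    show "inj_on p z" using p unfolding inj_on_def by metis
    show "p ` z \<subseteq> A"
    proof
      fix x assume "x \<in> p ` z"
      then obtain e where e: "e \<in> z" "x = p e" by blast
      with p have "{f \<in> z. x \<in> f} = {e}" by blast
      with e p show "x \<in> A" unfolding A_def by auto
    qed
    show "finite A" using fin by (rule finite_subset[rotated]) (auto simp: A_def)
  qed
  with A show "3 * card z \<le> 2 * card (\<Union>z)" by simp
qed

lemma half_factorial_degree_two:
  assumes "\<forall>e\<in>E. card e = 2" "finite E" "card (\<Union>E) \<le> 5"
    and deg: "\<And>x. card {e \<in> E. x \<in> e} \<le> 2"
  shows "half_factorial E"
  unfolding half_factorial_def
proof (intro allI impI, elim conjE)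
  fix z w assume z: "finite z" "z \<subseteq> E" "irredundant z"
    and w: "finite w" "w \<subseteq> E" "irredundant w" and eq: "\<Union>z = \<Union>w"
  have deg': "card {e \<in> v. x \<in> e} \<le> 2" if "v \<subseteq> E" for v x
  proof -
    have "card {e \<in> v. x \<in> e} \<le> card {e \<in> E. x \<in> e}"
      using assms(2) that by (intro card_mono) auto
    with deg[of x] show ?thesis by simp
  qed
  have "finite (\<Union>E)" using assms(1,2) by (metis card.infinite finite_Union zero_neq_numeral)
  then have "card (\<Union>z) \<le> 5" using z(2) assms(3) by (meson Union_mono card_mono order_trans)
  moreover have "card (\<Union>z) \<le> 2 * card z" "3 * card z \<le> 2 * card (\<Union>z)"
    using irredundant_card_bounds[OF z(1,3) _ deg'[OF z(2)]] assms(1) z(2) by blast+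
  moreover have "card (\<Union>z) \<le> 2 * card w" "3 * card w \<le> 2 * card (\<Union>z)"
    using irredundant_card_bounds[OF w(1,3) _ deg'[OF w(2)]] assms(1) w(2) eq by auto
  \<comment> \<open>The only value in range is \<open>n / 2\<close> rounded up; for
    \<open>n = 1\<close> the two bounds contradict each other.\<close>
  moreover have "p = (n + 1) div 2" if "n \<le> 5" "n \<le> 2 * p" "3 * p \<le> 2 * n" for n p :: nat
  proof -
    have "n = 0 \<or> n = 1 \<or> n = 2 \<or> n = 3 \<or> n = 4 \<or> n = 5" using that(1) by linarith
    then show ?thesis using that(2,3) by (elim disjE) auto
  qed
  ultimately show "card z = card w" by metis
qed

section \<open>Short paths and cycles\<close>

text \<open>Adjacency as a relation on points, for a bare family \<open>E\<close>. The inequality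
  discards one-element members, since \<open>{u, u}\<close> is \<open>{u}\<close>.\<close>

definition adj :: "'a set set \<Rightarrow> 'a \<Rightarrow> 'a \<Rightarrow> bool" where
  "adj E u v \<longleftrightarrow> u \<noteq> v \<and> {u, v} \<in> E"

lemma adj_sym: "adj E u v \<Longrightarrow> adj E v u"
  by (auto simp: adj_def insert_commute)

lemma adj_neq: "adj E u v \<Longrightarrow> u \<noteq> v"
  by (simp add: adj_def)

text \<open>The pattern is a subgraph, not an induced subgraph: extra edges among the named vertices
  are allowed. Six vertices mean five edges, one more than the permitted diameter.\<close>

definition path6_free :: "'a set set \<Rightarrow> bool" where
  "path6_free E \<longleftrightarrow> \<not> (\<exists>a b c d e f. distinct [a, b, c, d, e, f] \<and>
     adj E a b \<and> adj E b c \<and> adj E c d \<and> adj E d e \<and> adj E e f)"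

definition triangle_free :: "'a set set \<Rightarrow> bool" where
  "triangle_free E \<longleftrightarrow> \<not> (\<exists>a b c. adj E a b \<and> adj E b c \<and> adj E c a)"

definition square_free :: "'a set set \<Rightarrow> bool" where
  "square_free E \<longleftrightarrow> \<not> (\<exists>a b c d. distinct [a, b, c, d] \<and>
     adj E a b \<and> adj E b c \<and> adj E c d \<and> adj E d a)"

definition pentagon_free :: "'a set set \<Rightarrow> bool" where
  "pentagon_free E \<longleftrightarrow> \<not> (\<exists>a b c d e. distinct [a, b, c, d, e] \<and>
     adj E a b \<and> adj E b c \<and> adj E c d \<and> adj E d e \<and> adj E e a)"

text \<open>Three disjoint edges, the first, third and fifth, cover the path; so do the four edges
  left when the middle one is dropped, where each edge owns the end that it does not share.\<close>

lemma half_factorial_imp_path6_free: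
  assumes "half_factorial E"
  shows "path6_free E"
  unfolding path6_free_def
proof (rule notI, elim exE conjE)
  fix a b c d e f assume dist: "distinct [a, b, c, d, e, f]"
    and adj: "adj E a b" "adj E b c" "adj E c d" "adj E d e" "adj E e f"
  let ?z = "{{a, b}, {c, d}, {e, f}}" and ?w = "{{a, b}, {b, c}, {d, e}, {e, f}}"
  have "irredundant ?z" "irredundant ?w"
    using dist unfolding irredundant_def by (auto simp: doubleton_eq_iff)
  moreover have "\<Union>?z = \<Union>?w" by auto
  moreover have "?z \<subseteq> E" "?w \<subseteq> E" using adj by (auto simp: adj_def)
  ultimately have "card ?z = card ?w" using half_factorialD[OF assms, of ?z ?w] by blast
  moreover have "card ?z = 3" "card ?w = 4" using dist by (auto simp: card_insert_if doubleton_eq_iff)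
  ultimately show False by simp
qed

text \<open>With a fourth vertex \<open>d\<close>, the star \<open>ab, ac, ad\<close> and the pair
  \<open>ad, bc\<close> both cover the four vertices irredundantly, with sizes 3 and 2. The
  conclusion is phrased so as to confine the neighbours of a triangle vertex.\<close>

lemma half_factorial_imp_paw_free:
  assumes "half_factorial E" "adj E a b" "adj E b c" "adj E c a" "adj E a d"
  shows "d = b \<or> d = c"
proof (rule ccontr)
  assume "\<not> (d = b \<or> d = c)"
  then have dist: "distinct [a, b, c, d]" using assms by (auto simp: adj_def)
  let ?z = "{{a, d}, {b, c}}" and ?w = "{{a, b}, {a, c}, {a, d}}"
  have "irredundant ?z" "irredundant ?w"
    using dist unfolding irredundant_def by (auto simp: doubleton_eq_iff)
  moreover have "\<Union>?z = \<Union>?w" by auto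
  moreover have "?z \<subseteq> E" "?w \<subseteq> E" using assms by (auto simp: adj_def insert_commute)
  ultimately have "card ?z = card ?w" using half_factorialD[OF assms(1), of ?z ?w] by blast
  moreover have "card ?z = 2" "card ?w = 3" using dist by (auto simp: card_insert_if doubleton_eq_iff)
  ultimately show False by simp
qed

section \<open>Connectedness and crossing edges\<close>

lemma successively_crossing:
  assumes "successively R p" "p \<noteq> []" "hd p \<in> K" "last p \<notin> K"
  shows "\<exists>x\<in>set p \<inter> K. \<exists>y\<in>set p - K. R x y"
  using assms
proof (induction p)
  case Nil
  then show ?case by simp
next
  case (Cons x p)
  then have "p \<noteq> []" by auto
  then have xp: "R x (hd p)" "successively R p" using Cons.prems(1) by (simp_all add: successively_Cons)
  show ?case
  proof (cases "hd p \<in> K")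
    case True
    then show ?thesis using Cons.IH[OF xp(2) \<open>p \<noteq> []\<close>] Cons.prems(4) \<open>p \<noteq> []\<close> by auto
  next
    case False
    then show ?thesis using xp(1) Cons.prems(3) \<open>p \<noteq> []\<close> by auto
  qed
qed

lemma connected_graph_crossing_edge:
  assumes "connected_graph G" "u \<in> verts G" "u \<in> K" "v \<in> verts G" "v \<notin> K"
  obtains x y where "x \<in> K" "y \<notin> K" "adj (edges G) x y" "x \<in> verts G" "y \<in> verts G"
proof -
  obtain p where p: "is_walk G p" "hd p = u" "last p = v"
    using assms unfolding connected_graph_def is_path_def by blast
  then obtain x y where "x \<in> set p \<inter> K" "y \<in> set p - K" "{x, y} \<in> edges G"
    using successively_crossing[of _ p K] assms(3,5) unfolding is_walk_def by blast
  then show ?thesis using that[of x y] p(1) unfolding is_walk_def adj_def by blast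
qed

text \<open>This is how a component is shown to contain nothing beyond a given set: a path leaving
  \<open>K\<close> would have to cross its boundary along an edge.\<close>

lemma connected_graph_induct:
  assumes "connected_graph G" "u \<in> verts G" "u \<in> K"
    and "\<And>x y. x \<in> K \<Longrightarrow> adj (edges G) x y \<Longrightarrow> y \<in> K"
  shows "verts G \<subseteq> K"
  using connected_graph_crossing_edge[OF assms(1-3)] assms(4) by blast

lemma connected_graphD:
  assumes "connected_graph G"
  shows "simple_graph G" "verts G \<noteq> {}" "\<forall>e\<in>edges G. card e = 2" "\<forall>e\<in>edges G. e \<subseteq> verts G"
  using assms by (simp_all add: connected_graph_def simple_graph_def)

section \<open>Cycles and diameter through forbidden patterns\<close>

lemma cycle_graph_3_iff:
  "cycle_graph 3 G \<longleftrightarrow> (\<exists>a b c. distinct [a, b, c] \<and> verts G = {a, b, c} \<and>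
     edges G = {{a, b}, {b, c}, {c, a}})"
proof -
  have len: "length p = 3 \<longleftrightarrow> (\<exists>a b c. p = [a, b, c])" for p :: "'a list"
    by (auto simp: length_Suc_conv eval_nat_numeral)
  have ex: "(\<exists>p. distinct p \<and> length p = 3 \<and> P p) \<longleftrightarrow> (\<exists>a b c. distinct [a, b, c] \<and> P [a, b, c])"
    for P :: "'a list \<Rightarrow> bool"
    unfolding len by blast
  have img: "{f i | i. i < 3} = {f 0, f 1, f 2}" for f :: "nat \<Rightarrow> 'a set"
    by (auto simp: less_Suc_eq eval_nat_numeral)
  show ?thesis unfolding cycle_graph_def ex img by simp
qed

lemma cycle_graph_4_iff:
  "cycle_graph 4 G \<longleftrightarrow> (\<exists>a b c d. distinct [a, b, c, d] \<and> verts G = {a, b, c, d} \<and>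
     edges G = {{a, b}, {b, c}, {c, d}, {d, a}})"
proof -
  have len: "length p = 4 \<longleftrightarrow> (\<exists>a b c d. p = [a, b, c, d])" for p :: "'a list"
    by (auto simp: length_Suc_conv eval_nat_numeral)
  have ex: "(\<exists>p. distinct p \<and> length p = 4 \<and> P p) \<longleftrightarrow> (\<exists>a b c d. distinct [a, b, c, d] \<and> P [a, b, c, d])"
    for P :: "'a list \<Rightarrow> bool"
    unfolding len by blast
  have img: "{f i | i. i < 4} = {f 0, f 1, f 2, f 3}" for f :: "nat \<Rightarrow> 'a set"
    by (auto simp: less_Suc_eq eval_nat_numeral)
  show ?thesis unfolding cycle_graph_def ex img by simp
qed

lemma cycle_graph_5_iff:
  "cycle_graph 5 G \<longleftrightarrow> (\<exists>a b c d e. distinct [a, b, c, d, e] \<and> verts G = {a, b, c, d, e} \<and>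
     edges G = {{a, b}, {b, c}, {c, d}, {d, e}, {e, a}})"
proof -
  have len: "length p = 5 \<longleftrightarrow> (\<exists>a b c d e. p = [a, b, c, d, e])" for p :: "'a list"
    by (auto simp: length_Suc_conv eval_nat_numeral)
  have ex: "(\<exists>p. distinct p \<and> length p = 5 \<and> P p) \<longleftrightarrow> (\<exists>a b c d e. distinct [a, b, c, d, e] \<and> P [a, b, c, d, e])"
    for P :: "'a list \<Rightarrow> bool"
    unfolding len by blast
  have img: "{f i | i. i < 5} = {f 0, f 1, f 2, f 3, f 4}" for f :: "nat \<Rightarrow> 'a set"
    by (auto simp: less_Suc_eq eval_nat_numeral)
  show ?thesis unfolding cycle_graph_def ex img by simp
qed

lemma contains_cycle_3_iff:
  assumes "simple_graph G"
  shows "contains_cycle G 3 \<longleftrightarrow> \<not> triangle_free (edges G)"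
proof
  assume "contains_cycle G 3"
  then obtain H where H: "subgraph H G" "cycle_graph 3 H" unfolding contains_cycle_def by blast
  from H(2) obtain a b c where dist: "distinct [a, b, c]" and edges: "edges H = {{a, b}, {b, c}, {c, a}}"
    unfolding cycle_graph_3_iff by (elim exE conjE) (rule that)
  from H(1) have "edges H \<subseteq> edges G" by (simp add: subgraph_def)
  with edges dist have "adj (edges G) a b" "adj (edges G) b c" "adj (edges G) c a" by (auto simp: adj_def)
  then show "\<not> triangle_free (edges G)" unfolding triangle_free_def by blast
next
  assume "\<not> triangle_free (edges G)"
  then obtain a b c where abc: "adj (edges G) a b" "adj (edges G) b c" "adj (edges G) c a"
    unfolding triangle_free_def by blast
  let ?H = "\<lparr>verts = {a, b, c}, edges = {{a, b}, {b, c}, {c, a}}\<rparr>"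
  have "subgraph ?H G" using abc assms unfolding subgraph_def simple_graph_def adj_def by auto
  moreover have "cycle_graph 3 ?H" unfolding cycle_graph_3_iff
    by (intro exI[of _ a] exI[of _ b] exI[of _ c]) (use abc in \<open>auto simp: adj_def\<close>)
  ultimately show "contains_cycle G 3" unfolding contains_cycle_def by (intro exI conjI)
qed

lemma contains_cycle_4_iff:
  assumes "simple_graph G"
  shows "contains_cycle G 4 \<longleftrightarrow> \<not> square_free (edges G)"
proof
  assume "contains_cycle G 4"
  then obtain H where H: "subgraph H G" "cycle_graph 4 H" unfolding contains_cycle_def by blast
  from H(2) obtain a b c d where dist: "distinct [a, b, c, d]" and edges: "edges H = {{a, b}, {b, c}, {c, d}, {d, a}}"
    unfolding cycle_graph_4_iff by (elim exE conjE) (rule that)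
  from H(1) have "edges H \<subseteq> edges G" by (simp add: subgraph_def)
  with edges dist have "adj (edges G) a b" "adj (edges G) b c" "adj (edges G) c d" "adj (edges G) d a"
    by (auto simp: adj_def)
  with dist show "\<not> square_free (edges G)" unfolding square_free_def by blast
next
  assume "\<not> square_free (edges G)"
  then obtain a b c d where abcd: "distinct [a, b, c, d]"
    "adj (edges G) a b" "adj (edges G) b c" "adj (edges G) c d" "adj (edges G) d a"
    unfolding square_free_def by blast
  let ?H = "\<lparr>verts = {a, b, c, d}, edges = {{a, b}, {b, c}, {c, d}, {d, a}}\<rparr>"
  have "subgraph ?H G" using abcd assms unfolding subgraph_def simple_graph_def adj_def by auto
  moreover have "cycle_graph 4 ?H" unfolding cycle_graph_4_iff
    by (intro exI[of _ a] exI[of _ b] exI[of _ c] exI[of _ d]) (use abcd in auto)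
  ultimately show "contains_cycle G 4" unfolding contains_cycle_def by (intro exI conjI)
qed

lemma contains_cycle_5_iff:
  assumes "simple_graph G"
  shows "contains_cycle G 5 \<longleftrightarrow> \<not> pentagon_free (edges G)"
proof
  assume "contains_cycle G 5"
  then obtain H where H: "subgraph H G" "cycle_graph 5 H" unfolding contains_cycle_def by blast
  from H(2) obtain a b c d e where dist: "distinct [a, b, c, d, e]" and edges: "edges H = {{a, b}, {b, c}, {c, d}, {d, e}, {e, a}}"
    unfolding cycle_graph_5_iff by (elim exE conjE) (rule that)
  from H(1) have "edges H \<subseteq> edges G" by (simp add: subgraph_def)
  with edges dist have "adj (edges G) a b" "adj (edges G) b c" "adj (edges G) c d" "adj (edges G) d e"
    "adj (edges G) e a"
    by (auto simp: adj_def)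
  with dist show "\<not> pentagon_free (edges G)" unfolding pentagon_free_def by blast
next
  assume "\<not> pentagon_free (edges G)"
  then obtain a b c d e where abcde: "distinct [a, b, c, d, e]"
    "adj (edges G) a b" "adj (edges G) b c" "adj (edges G) c d" "adj (edges G) d e"
    "adj (edges G) e a"
    unfolding pentagon_free_def by blast
  let ?H = "\<lparr>verts = {a, b, c, d, e}, edges = {{a, b}, {b, c}, {c, d}, {d, e}, {e, a}}\<rparr>"
  have "subgraph ?H G" using abcde assms unfolding subgraph_def simple_graph_def adj_def by auto
  moreover have "cycle_graph 5 ?H" unfolding cycle_graph_5_iff
    by (intro exI[of _ a] exI[of _ b] exI[of _ c] exI[of _ d] exI[of _ e]) (use abcde in auto)
  ultimately show "contains_cycle G 5" unfolding contains_cycle_def by (intro exI conjI)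
qed

text \<open>Shared by long paths and long cycles: the first six entries already form the forbidden
  path. The edge hypothesis carries no length bound, but the case to refute is a list with at least
  six entries, where all these indices are genuine.\<close>

lemma path6_free_nth:
  assumes "path6_free E" "distinct p" "\<And>i. i < 5 \<Longrightarrow> {p ! i, p ! Suc i} \<in> E"
  shows "length p \<le> 5"
proof (rule ccontr)
  assume "\<not> length p \<le> 5"
  then have len: "length p > 5" by simp
  have neq: "p ! i \<noteq> p ! j" if "i \<noteq> j" "i < 6" "j < 6" for i j
    using assms(2) len that by (simp add: nth_eq_iff_index_eq)
  have "distinct [p ! 0, p ! 1, p ! 2, p ! 3, p ! 4, p ! 5]" by (simp add: neq)
  moreover have "adj E (p ! i) (p ! Suc i)" if "i < 5" for i
    using assms(3)[OF that] neq[of i "Suc i"] that by (simp add: adj_def)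
  from this[of 0] this[of 1] this[of 2] this[of 3] this[of 4]
  have "adj E (p ! 0) (p ! 1)" "adj E (p ! 1) (p ! 2)" "adj E (p ! 2) (p ! 3)"
    "adj E (p ! 3) (p ! 4)" "adj E (p ! 4) (p ! 5)"
    by (simp_all add: eval_nat_numeral)
  ultimately show False using assms(1) unfolding path6_free_def by blast
qed

lemma diameter_le_4_iff:
  assumes "simple_graph G"
  shows "diameter G \<le> 4 \<longleftrightarrow> path6_free (edges G)"
proof -
  have "diameter G \<le> 4 \<longleftrightarrow> (\<forall>p. is_path G p \<longrightarrow> enat (length p - 1) \<le> enat 4)"
    unfolding diameter_def SUP_le_iff by (simp add: numeral_eq_enat)
  also have "\<dots> \<longleftrightarrow> (\<forall>p. is_path G p \<longrightarrow> length p \<le> 5)"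
    by auto
  also have "\<dots> \<longleftrightarrow> path6_free (edges G)"
  proof
    assume short: "\<forall>p. is_path G p \<longrightarrow> length p \<le> 5"
    show "path6_free (edges G)" unfolding path6_free_def
    proof (rule notI, elim exE conjE)
      fix a b c d e f assume "distinct [a, b, c, d, e, f]" "adj (edges G) a b" "adj (edges G) b c"
        "adj (edges G) c d" "adj (edges G) d e" "adj (edges G) e f"
      then have "is_path G [a, b, c, d, e, f]"
        using assms unfolding is_path_def is_walk_def simple_graph_def adj_def by auto
      with short show False by fastforce
    qed
  next
    assume free: "path6_free (edges G)"
    show "\<forall>p. is_path G p \<longrightarrow> length p \<le> 5"
    proof (intro allI impI, rule ccontr)
      fix p assume p: "is_path G p" and len: "\<not> length p \<le> 5"
      have "{p ! i, p ! Suc i} \<in> edges G" if "i < 5" for i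
        using p len that unfolding is_path_def is_walk_def successively_conv_nth by simp
      then show False using path6_free_nth[OF free, of p] p len unfolding is_path_def by blast
    qed
  qed
  finally show ?thesis .
qed

text \<open>Six consecutive vertices of a longer cycle form the forbidden path. For
  \<open>i < 5\<close> and \<open>k \<ge> 6\<close> the successor \<open>(i + 1) mod k\<close> does
  not wrap around.\<close>

lemma path6_free_contains_cycle:
  assumes "path6_free (edges G)" "contains_cycle G k"
  shows "k = 3 \<or> k = 4 \<or> k = 5"
proof (rule ccontr)
  assume *: "\<not> (k = 3 \<or> k = 4 \<or> k = 5)"
  obtain H where "subgraph H G" and cyc: "cycle_graph k H"
    using assms(2) unfolding contains_cycle_def by blast
  then have H: "edges H \<subseteq> edges G" by (simp add: subgraph_def)
  from cyc obtain c where c: "k \<ge> 3" "distinct c" "length c = k"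
    "edges H = {{c ! i, c ! ((i + 1) mod k)} | i. i < k}"
    unfolding cycle_graph_def by (elim exE conjE) (rule that)
  have "k \<ge> 6" using * c(1) by linarith
  have "{c ! i, c ! Suc i} \<in> edges G" if "i < 5" for i
  proof -
    have i: "(i + 1) mod k = Suc i" "i < k" using that \<open>k \<ge> 6\<close> by simp_all
    have "{c ! i, c ! ((i + 1) mod k)} \<in> edges H" unfolding c(4) using i(2) by blast
    then have "{c ! i, c ! Suc i} \<in> edges H" unfolding i(1) .
    with H show ?thesis by blast
  qed
  then have "length c \<le> 5" by (rule path6_free_nth[OF assms(1) c(2)])
  with c(3) \<open>k \<ge> 6\<close> show False by simp
qed

section \<open>Connected half-factorial graphs\<close>

text \<open>The centre is chosen so that no path on four vertices starts at it. Then every vertex is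
  within two steps of \<open>c\<close>, and a vertex two steps away has a single neighbour: another
  one would prolong the path or close a triangle.\<close>

lemma tree_centre_exists:
  assumes conn: "connected_graph G"
    and path6: "path6_free (edges G)" and triangle: "triangle_free (edges G)"
    and square: "square_free (edges G)" and pentagon: "pentagon_free (edges G)"
  obtains c where "\<And>e. e \<in> edges G \<Longrightarrow> c \<notin> e \<Longrightarrow> \<exists>x\<in>e. \<forall>f\<in>edges G. x \<in> f \<longrightarrow> f = e"
proof -
  let ?R = "adj (edges G)"
  note sym = adj_sym[of "edges G"]
  have neq: "?R u v \<Longrightarrow> u \<noteq> v" for u v by (rule adj_neq)
  have no6: False if "distinct [a, b, c, d, e, f]" "?R a b" "?R b c" "?R c d" "?R d e" "?R e f"
    for a b c d e f
    using that path6 unfolding path6_free_def by blast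
  have no3: False if "?R a b" "?R b c" "?R c a" for a b c
    using that triangle unfolding triangle_free_def by blast
  have no4: False if "distinct [a, b, c, d]" "?R a b" "?R b c" "?R c d" "?R d a" for a b c d
    using that square unfolding square_free_def by blast
  have no5: False if "distinct [a, b, c, d, e]" "?R a b" "?R b c" "?R c d" "?R d e" "?R e a"
    for a b c d e
    using that pentagon unfolding pentagon_free_def by blast
  \<comment> \<open>A neighbour \<open>b\<close> of \<open>c\<close> other than \<open>m\<close>
    that met the path would close a triangle at \<open>k\<close> or a square at
    \<open>w\<close>.\<close>
  have off_path: "b \<noteq> k" "b \<noteq> w"
    if "distinct [c, m, k, w]" "?R c m" "?R m k" "?R k w" "?R c b" "m \<noteq> b" for b c m k w
  proof -
    show "b \<noteq> k" using no3[of c m k] that sym by blast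
    show "b \<noteq> w" using no4[of c m k w] that sym by blast
  qed
  \<comment> \<open>A two-edge arm and a three-edge path from \<open>c\<close> with different first
    steps meet only in \<open>c\<close>, since any other coincidence closes a cycle of length 3, 4
    or 5; together they have six vertices.\<close>
  have arm: False
    if path: "distinct [c, m, k, w]" "?R c m" "?R m k" "?R k w"
      and "?R c b" "?R b a" "a \<noteq> c" "m \<noteq> b" for a b c m k w
  proof -
    have b: "b \<noteq> k" "b \<noteq> w" using off_path[of c m k w b] that by blast+
    have "a \<noteq> m" using no3[of c b a] that sym by blast
    moreover have "a \<noteq> k" using no4[of c m k b] that b sym neq by (auto dest: neq)
    moreover have "a \<noteq> w" using no5[of c m k w b] that b sym by (auto dest: neq)
    ultimately show False
      using no6[of a b c m k w] that b sym by (auto dest: neq)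
  qed
  \<comment> \<open>The centre is the middle of a path on five vertices if there is one, else any vertex of degree at least 2.\<close>
  obtain c where c: "c \<in> verts G"
    and short: "\<And>m k w. ?R c m \<Longrightarrow> ?R m k \<Longrightarrow> ?R k w \<Longrightarrow> \<not> distinct [c, m, k, w]"
  proof (cases "\<exists>a b c d e. distinct [a, b, c, d, e] \<and> ?R a b \<and> ?R b c \<and> ?R c d \<and> ?R d e")
    case True
    then obtain a b c d e where p: "distinct [a, b, c, d, e]" "?R a b" "?R b c" "?R c d" "?R d e"
      by blast
    show ?thesis
    proof (rule that[of c])
      show "c \<in> verts G" using p(3) connected_graphD(4)[OF conn] by (auto simp: adj_def)
      fix m k w assume R: "?R c m" "?R m k" "?R k w"
      show "\<not> distinct [c, m, k, w]"
      proof
        assume dist: "distinct [c, m, k, w]"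
        show False
        \<comment> \<open>The path starts through at most one of \<open>b\<close> and
          \<open>d\<close>, so the arm through the other one applies.\<close>
        proof (cases "m = b")
          case True
          then show False using arm[OF dist R, of d e] p by auto
        next
          case False
          then show False using arm[OF dist R, of b a] p sym by auto
        qed
      qed
    qed
  next
    case no_path5: False
    show ?thesis
    proof (cases "\<exists>b c d. b \<noteq> d \<and> ?R c b \<and> ?R c d")
      case True
      then obtain b c d where p: "b \<noteq> d" "?R c b" "?R c d" by blast
      show ?thesis
      proof (rule that[of c])
        show "c \<in> verts G" using p(2) connected_graphD(4)[OF conn] by (auto simp: adj_def)
        fix m k w assume R: "?R c m" "?R m k" "?R k w"
        show "\<not> distinct [c, m, k, w]"
        proof
          assume dist: "distinct [c, m, k, w]"
          \<comment> \<open>Of the two neighbours of \<open>c\<close> one is not \<open>m\<close>;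
            put in front of the path it would make a path on five vertices.\<close>
          obtain x where x: "?R c x" "m \<noteq> x" using p by blast
          then have "x \<noteq> k" "x \<noteq> w" using off_path[OF dist R] by blast+
          then have "distinct [x, c, m, k, w]" using dist x neq[OF x(1)] by auto
          with no_path5 R sym[OF x(1)] show False by blast
        qed
      qed
    next
      \<comment> \<open>No vertex has two neighbours here, so there is not even a path on three
        vertices and any vertex serves as centre.\<close>
      case False
      obtain c where "c \<in> verts G" using connected_graphD(2)[OF conn] by blast
      moreover have "\<not> distinct [c, m, k, w]" if "?R c m" "?R m k" for m k w
        using that False sym by (metis distinct_length_2_or_more)
      ultimately show ?thesis using that by blast
    qed
  qed
  define K where "K = {c} \<union> {x. ?R c x} \<union> {x. \<exists>m. ?R c m \<and> ?R m x}"
  have "verts G \<subseteq> K"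
    using conn c
  proof (rule connected_graph_induct)
    show "c \<in> K" unfolding K_def by blast
    fix x y assume x: "x \<in> K" and xy: "?R x y"
    show "y \<in> K"
    proof (rule ccontr)
      assume y: "y \<notin> K"
      then have "x \<noteq> c" "\<not> ?R c x" using xy unfolding K_def by blast+
      with x obtain m where m: "?R c m" "?R m x" unfolding K_def by blast
      then have "distinct [c, m, x, y]" using y \<open>x \<noteq> c\<close> xy unfolding K_def by (auto dest: neq)
      with short[OF m xy] show False by blast
    qed
  qed
  have pendant: "\<forall>f\<in>edges G. q \<in> f \<longrightarrow> f = {p, q}" if "?R c p" "?R p q" "q \<noteq> c" for p q
  proof (intro ballI impI)
    fix f assume f: "f \<in> edges G" "q \<in> f"
    then obtain r where r: "f = {q, r}" "r \<noteq> q"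
      using card_2_other_element connected_graphD(3)[OF conn] by metis
    then have "?R q r" using f by (auto simp: adj_def)
    moreover have "r \<noteq> c" using no3[of c p q] that \<open>?R q r\<close> by blast
    ultimately have "r = p" using short[OF that(1,2), of r] that by (auto dest: neq)
    with r show "f = {p, q}" by blast
  qed
  show ?thesis
  proof (rule that[of c])
    fix e assume e: "e \<in> edges G" "c \<notin> e"
    then obtain p q where pq: "e = {p, q}" "p \<noteq> q"
      using connected_graphD(3)[OF conn] by (meson card_2_iff)
    then have R: "?R p q" using e by (auto simp: adj_def)
    have "p \<in> K" using e pq connected_graphD(4)[OF conn] \<open>verts G \<subseteq> K\<close> by blast
    moreover have "p \<noteq> c" "q \<noteq> c" using e pq by auto
    ultimately consider "?R c p" | m where "?R c m" "?R m p" unfolding K_def by blast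
    then show "\<exists>x\<in>e. \<forall>f\<in>edges G. x \<in> f \<longrightarrow> f = e"
    proof cases
      case 1
      then have "\<forall>f\<in>edges G. q \<in> f \<longrightarrow> f = e" using pendant R \<open>q \<noteq> c\<close> pq(1) by simp
      then show ?thesis using pq(1) by blast
    next
      case 2
      \<comment> \<open>\<open>p\<close> is two steps from \<open>c\<close> through
        \<open>m\<close>, so an edge from \<open>p\<close> to anything but \<open>m\<close> would
        complete a path on four vertices. Here the leaf is \<open>p\<close>.\<close>
      then have "q = m" using short[OF 2 R] \<open>p \<noteq> c\<close> \<open>q \<noteq> c\<close> R by (auto dest: neq)
      then have "?R c q" using 2 by simp
      then have "\<forall>f\<in>edges G. p \<in> f \<longrightarrow> f = e"
        using pendant[OF _ sym[OF R] \<open>p \<noteq> c\<close>] pq(1) by (simp add: insert_commute)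
      then show ?thesis using pq(1) by blast
    qed
  qed
qed

text \<open>Neighbours outside a square cannot hang on two adjacent corners, since together with the
  four corners they would form a path on six vertices. So one pair of opposite corners carries
  everything attached to the square, and these two are the hubs.\<close>

lemma hub_pair_exists:
  assumes conn: "connected_graph G"
    and path6: "path6_free (edges G)" and triangle: "triangle_free (edges G)"
    and square: "\<not> square_free (edges G)"
  obtains a b where "\<forall>e\<in>edges G. (a \<in> e) \<noteq> (b \<in> e)"
proof -
  let ?R = "adj (edges G)"
  note sym = adj_sym[of "edges G"]
  have neq: "?R u v \<Longrightarrow> u \<noteq> v" for u v by (rule adj_neq)
  have no6: False if "distinct [a, b, c, d, e, f]" "?R a b" "?R b c" "?R c d" "?R d e" "?R e f"
    for a b c d e f
    using that path6 unfolding path6_free_def by blast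
  have no3: False if "?R a b" "?R b c" "?R c a" for a b c
    using that triangle unfolding triangle_free_def by blast
  have hub: "\<forall>e\<in>edges G. (a \<in> e) \<noteq> (c \<in> e)"
    if sq: "distinct [a, b, c, d]" "?R a b" "?R b c" "?R c d" "?R d a"
      and b: "\<And>q. ?R b q \<Longrightarrow> q = a \<or> q = c" and d: "\<And>q. ?R d q \<Longrightarrow> q = a \<or> q = c" for a b c d
  proof -
    \<comment> \<open>An edge \<open>xy\<close> avoiding both hubs, with \<open>x\<close> next to
      one of them, would start a path on six vertices: \<open>y\<close>, \<open>x\<close>, then
      around the square from that hub.\<close>
    have claim: "?R a x \<or> ?R c x \<Longrightarrow> ?R x y \<Longrightarrow> x = a \<or> x = c \<or> y = a \<or> y = c" for x y
    proof (rule ccontr)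
      assume x: "?R a x \<or> ?R c x" and xy: "?R x y" and "\<not> (x = a \<or> x = c \<or> y = a \<or> y = c)"
      then have ne: "x \<noteq> a" "x \<noteq> c" "y \<noteq> a" "y \<noteq> c" by auto
      moreover have "x \<noteq> b" "x \<noteq> d" "y \<noteq> b" "y \<noteq> d" using b d xy sym[OF xy] ne by blast+
      ultimately have "distinct [y, x, a, b, c, d]" "distinct [y, x, c, b, a, d]"
        using sq(1) neq[OF xy] by auto
      then show False
        using x no6[of y x a b c d] no6[of y x c b a d] xy sq(2-5) sym by blast
    qed
    have "verts G \<subseteq> {a, c} \<union> {x. ?R a x \<or> ?R c x}" (is "_ \<subseteq> ?K")
      using conn
    proof (rule connected_graph_induct)
      show "a \<in> verts G" using sq(2) connected_graphD(4)[OF conn] by (auto simp: adj_def)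
      show "a \<in> ?K" by blast
      show "y \<in> ?K" if "x \<in> ?K" "?R x y" for x y using claim[of x y] that by blast
    qed
    show ?thesis
    proof
      fix e assume e: "e \<in> edges G"
      then obtain p q where pq: "e = {p, q}" "p \<noteq> q"
        using connected_graphD(3)[OF conn] by (meson card_2_iff)
      then have R: "?R p q" using e by (auto simp: adj_def)
      have "p \<in> ?K" using e pq connected_graphD(4)[OF conn] \<open>verts G \<subseteq> ?K\<close> by blast
      then have "a \<in> e \<or> c \<in> e" using claim[of p q] R pq(1) by blast
      moreover have "\<not> (a \<in> e \<and> c \<in> e)"
      proof
        assume "a \<in> e \<and> c \<in> e"
        then have "?R c a" using R pq sq(1) sym[OF R] by auto
        with no3[of a b c] sq(2,3) show False by blast
      qed
      ultimately show "(a \<in> e) \<noteq> (c \<in> e)" by blast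
    qed
  qed
  \<comment> \<open>The square is rotated by one place, so \<open>b\<close> and \<open>d\<close>
    become the hubs. It remains to see that \<open>c\<close> and \<open>a\<close> have no further
    neighbour \<open>y\<close>: otherwise \<open>q\<close> and \<open>y\<close> would be the ends of
    a path through all four corners.\<close>
  have hub': "\<forall>e\<in>edges G. (b \<in> e) \<noteq> (d \<in> e)"
    if sq: "distinct [a, b, c, d]" "?R a b" "?R b c" "?R c d" "?R d a"
      and q: "?R b q" "q \<noteq> a" "q \<noteq> c" for a b c d q
  proof (rule hub[of b c d a])
    have "q \<noteq> d" using no3[of a b d] q sq by blast
    show "y = b \<or> y = d" if "?R c y" for y
    proof (rule ccontr)
      assume y: "\<not> (y = b \<or> y = d)"
      have "y \<noteq> a" using no3[of a b c] sq that by blast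
      moreover have "y \<noteq> q" using no3[of c b q] sq q that sym by blast
      ultimately have "distinct [q, b, a, d, c, y]" using sq(1) y q \<open>q \<noteq> d\<close> neq[OF q(1)] neq[OF that] by auto
      then show False using no6[of q b a d c y] sq q that sym by blast
    qed
    show "y = b \<or> y = d" if "?R a y" for y
    proof (rule ccontr)
      assume y: "\<not> (y = b \<or> y = d)"
      have "y \<noteq> c" using no3[of a b c] sq that sym by blast
      moreover have "y \<noteq> q" using no3[of a b q] sq q that sym by blast
      ultimately have "distinct [q, b, c, d, a, y]" using sq(1) y q \<open>q \<noteq> d\<close> neq[OF q(1)] neq[OF that] by auto
      then show False using no6[of q b c d a y] sq q that sym by blast
    qed
  qed (use sq in auto)
  obtain a b c d where sq: "distinct [a, b, c, d]" "?R a b" "?R b c" "?R c d" "?R d a"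
    using square unfolding square_free_def by blast
  show ?thesis
  proof (cases "\<exists>q. q \<noteq> a \<and> q \<noteq> c \<and> (?R b q \<or> ?R d q)")
    case True
    then obtain q where "q \<noteq> a" "q \<noteq> c" "?R b q \<or> ?R d q" by blast
    then show ?thesis using hub'[OF sq, of q] hub'[of c d a b q] sq that by auto
  next
    case False
    then show ?thesis using hub[OF sq] that by blast
  qed
qed

lemma connected_half_factorial_imp_shape:
  assumes conn: "connected_graph C" and hf: "half_factorial (edges C)"
  shows "cycle_graph 3 C \<or> cycle_graph 5 C \<or> (is_tree C \<and> diameter C \<le> 4) \<or> candy_graph C"
proof -
  let ?E = "edges C" and ?R = "adj (edges C)"
  note simple = connected_graphD(1)[OF conn]
  note sym = adj_sym[of "edges C"]
  have in_verts: "u \<in> verts C" if "?R u v" for u v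
    using that connected_graphD(4)[OF conn] by (auto simp: adj_def)
  have edge: "\<exists>p q. e = {p, q} \<and> ?R p q" if "e \<in> ?E" for e
    using that connected_graphD(3)[OF conn] by (metis adj_def card_2_iff)
  have path6: "path6_free ?E" using hf by (rule half_factorial_imp_path6_free)
  then have diam: "diameter C \<le> 4" using diameter_le_4_iff[OF simple] by blast
  have triangle: "cycle_graph 3 C" if "\<not> triangle_free ?E"
  proof -
    obtain a b c where abc: "?R a b" "?R b c" "?R c a"
      using \<open>\<not> triangle_free ?E\<close> unfolding triangle_free_def by blast
    have "verts C \<subseteq> {a, b, c}"
      using conn in_verts[OF abc(1)]
    proof (rule connected_graph_induct)
      show "a \<in> {a, b, c}" by simp
      show "y \<in> {a, b, c}" if "x \<in> {a, b, c}" "?R x y" for x y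
        using that half_factorial_imp_paw_free[OF hf abc(1,2,3), of y]
          half_factorial_imp_paw_free[OF hf abc(2,3,1), of y]
          half_factorial_imp_paw_free[OF hf abc(3,1,2), of y] by auto
    qed
    then have verts: "verts C = {a, b, c}" using abc in_verts by blast
    have "?E = {{a, b}, {b, c}, {c, a}}"
    proof
      show "?E \<subseteq> {{a, b}, {b, c}, {c, a}}"
      proof
        fix e assume "e \<in> ?E"
        then obtain p q where pq: "e = {p, q}" "?R p q" using edge by blast
        moreover have "p \<in> {a, b, c}" "q \<in> {a, b, c}" "p \<noteq> q"
          using pq in_verts[OF pq(2)] in_verts[OF sym[OF pq(2)]] verts by (auto simp: adj_def)
        ultimately show "e \<in> {{a, b}, {b, c}, {c, a}}" by (auto simp: insert_commute)
      qed
      show "{{a, b}, {b, c}, {c, a}} \<subseteq> ?E" using abc by (auto simp: adj_def)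
    qed
    moreover have "distinct [a, b, c]" using abc by (auto simp: adj_def)
    ultimately show ?thesis unfolding cycle_graph_3_iff using verts by (intro exI conjI)
  qed
  have pentagon: "cycle_graph 5 C" if tf: "triangle_free ?E" and "\<not> pentagon_free ?E"
  proof -
    obtain a b c d e where dist: "distinct [a, b, c, d, e]"
      and p: "?R a b" "?R b c" "?R c d" "?R d e" "?R e a"
      using \<open>\<not> pentagon_free ?E\<close> unfolding pentagon_free_def by blast
    \<comment> \<open>A new neighbour \<open>y\<close> put in front of a path on five vertices would
      make six. Going round the pentagon, every vertex is the start of such a path.\<close>
    have no6: "y \<in> set [x, v, w, s, t]"
      if "distinct [x, v, w, s, t]" "?R x v" "?R v w" "?R w s" "?R s t" "?R x y" for x v w s t y
    proof (rule ccontr)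
      assume "y \<notin> set [x, v, w, s, t]"
      then have "distinct [y, x, v, w, s, t]" using that(1) by auto
      then show False using path6 that(2-6) sym unfolding path6_free_def by blast
    qed
    have "verts C \<subseteq> {a, b, c, d, e}"
      using conn in_verts[OF p(1)]
    proof (rule connected_graph_induct)
      show "a \<in> {a, b, c, d, e}" by simp
      show "y \<in> {a, b, c, d, e}" if "x \<in> {a, b, c, d, e}" "?R x y" for x y
      proof -
        from that(1) consider "x = a" | "x = b" | "x = c" | "x = d" | "x = e" by blast
        then show ?thesis
        proof cases
          case 1 then show ?thesis using no6[of a b c d e y] dist p that(2) by auto
        next
          case 2 then show ?thesis using no6[of b c d e a y] dist p that(2) by auto
        next
          case 3 then show ?thesis using no6[of c d e a b y] dist p that(2) by auto
        next
          case 4 then show ?thesis using no6[of d e a b c y] dist p that(2) by auto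
        next
          case 5 then show ?thesis using no6[of e a b c d y] dist p that(2) by auto
        qed
      qed
    qed
    then have verts: "verts C = {a, b, c, d, e}" using p in_verts by blast
    \<comment> \<open>A chord of a pentagon joins two vertices with a common neighbour.\<close>
    have no_chord: "\<not> ?R x z" if "?R x y" "?R y z" for x y z
      using that tf sym unfolding triangle_free_def by blast
    have chords: "\<not> ?R a c" "\<not> ?R b d" "\<not> ?R c e" "\<not> ?R d a" "\<not> ?R e b"
      "\<not> ?R c a" "\<not> ?R d b" "\<not> ?R e c" "\<not> ?R a d" "\<not> ?R b e"
      using no_chord p sym by blast+
    have "?E = {{a, b}, {b, c}, {c, d}, {d, e}, {e, a}}"
    proof
      show "?E \<subseteq> {{a, b}, {b, c}, {c, d}, {d, e}, {e, a}}"
      proof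
        fix f assume "f \<in> ?E"
        then obtain x y where xy: "f = {x, y}" "?R x y" using edge by blast
        have "x \<in> {a, b, c, d, e}" "y \<in> {a, b, c, d, e}" "x \<noteq> y"
          using xy in_verts[OF xy(2)] in_verts[OF sym[OF xy(2)]] verts by (auto simp: adj_def)
        with xy chords show "f \<in> {{a, b}, {b, c}, {c, d}, {d, e}, {e, a}}"
          by (elim insertE emptyE) (simp_all add: insert_commute)
      qed
      show "{{a, b}, {b, c}, {c, d}, {d, e}, {e, a}} \<subseteq> ?E" using p by (auto simp: adj_def)
    qed
    then show ?thesis unfolding cycle_graph_5_iff using verts dist by (intro exI conjI)
  qed
  show ?thesis
  proof (cases "triangle_free ?E \<and> pentagon_free ?E")
    case False
    then show ?thesis using triangle pentagon by blast
  next
    case True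
    then have cyc: "k = 4" if "contains_cycle C k" for k
      using path6_free_contains_cycle[OF path6 that] that contains_cycle_3_iff[OF simple]
        contains_cycle_5_iff[OF simple] by metis
    show ?thesis
    proof (cases "contains_cycle C 4")
      case True
      then have "candy_graph C" unfolding candy_graph_def using conn diam cyc by blast
      then show ?thesis by blast
    next
      case False
      then have "is_tree C" unfolding is_tree_def using conn cyc by blast
      then show ?thesis using diam by blast
    qed
  qed
qed

lemma connected_shape_imp_half_factorial:
  assumes conn: "connected_graph C"
    and shape: "cycle_graph 3 C \<or> cycle_graph 5 C \<or> (is_tree C \<and> diameter C \<le> 4) \<or> candy_graph C"
  shows "half_factorial (edges C)"
proof -
  let ?E = "edges C"
  note simple = connected_graphD(1)[OF conn] and two = connected_graphD(3)[OF conn]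
  have degree: "card {e \<in> E. x \<in> e} \<le> 2" if "{e \<in> E. x \<in> e} \<subseteq> {f, g}" for E :: "'a set set" and x f g
    using card_mono[OF _ that] card_insert_le_m1[of 2 "{g}" f] by auto
  from shape consider "cycle_graph 3 C" | "cycle_graph 5 C" | "is_tree C" "diameter C \<le> 4"
    | "candy_graph C" by blast
  then show ?thesis
  proof cases
    case 1
    then obtain a b c where abc: "distinct [a, b, c]" "?E = {{a, b}, {b, c}, {c, a}}"
      unfolding cycle_graph_3_iff by (elim exE conjE) (rule that)
    show ?thesis
    proof (rule half_factorial_degree_two[OF two])
      show "finite ?E" unfolding abc(2) by simp
      have "\<Union>?E = {a, b, c}" unfolding abc(2) by auto
      then show "card (\<Union>?E) \<le> 5" using abc(1) by simp
      fix x
      consider "x = a" | "x = b" | "x \<noteq> a" "x \<noteq> b" by blast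
      then show "card {e \<in> ?E. x \<in> e} \<le> 2"
      proof cases
        case 1 then show ?thesis unfolding abc(2) using abc(1) by (intro degree[of _ _ "{a, b}" "{c, a}"]) auto
      next
        case 2 then show ?thesis unfolding abc(2) using abc(1) by (intro degree[of _ _ "{a, b}" "{b, c}"]) auto
      next
        case 3 then show ?thesis unfolding abc(2) using abc(1) by (intro degree[of _ _ "{b, c}" "{c, a}"]) auto
      qed
    qed
  next
    case 2
    then obtain a b c d e where p: "distinct [a, b, c, d, e]"
      "?E = {{a, b}, {b, c}, {c, d}, {d, e}, {e, a}}"
      unfolding cycle_graph_5_iff by (elim exE conjE) (rule that)
    show ?thesis
    proof (rule half_factorial_degree_two[OF two])
      show "finite ?E" unfolding p(2) by simp
      have "\<Union>?E = {a, b, c, d, e}" unfolding p(2) by auto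
      then show "card (\<Union>?E) \<le> 5" using p(1) by simp
      fix x
      \<comment> \<open>The last case takes \<open>e\<close> together with all points off the cycle;
        the latter lie on no edge, so the same bounding pair of edges works.\<close>
      consider "x = a" | "x = b" | "x = c" | "x = d" | "x \<notin> {a, b, c, d}" by blast
      then show "card {f \<in> ?E. x \<in> f} \<le> 2"
      proof cases
        case 1 then show ?thesis unfolding p(2) using p(1) by (intro degree[of _ _ "{a, b}" "{e, a}"]) auto
      next
        case 2 then show ?thesis unfolding p(2) using p(1) by (intro degree[of _ _ "{a, b}" "{b, c}"]) auto
      next
        case 3 then show ?thesis unfolding p(2) using p(1) by (intro degree[of _ _ "{b, c}" "{c, d}"]) auto
      next
        case 4 then show ?thesis unfolding p(2) using p(1) by (intro degree[of _ _ "{c, d}" "{d, e}"]) auto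
      next
        case 5 then show ?thesis unfolding p(2) using p(1) by (intro degree[of _ _ "{d, e}" "{e, a}"]) auto
      qed
    qed
  next
    case 3
    then have "triangle_free ?E" "square_free ?E" "pentagon_free ?E" "path6_free ?E"
      using contains_cycle_3_iff[OF simple] contains_cycle_4_iff[OF simple]
        contains_cycle_5_iff[OF simple] diameter_le_4_iff[OF simple]
      unfolding is_tree_def by blast+
    then obtain c where "\<And>e. e \<in> ?E \<Longrightarrow> c \<notin> e \<Longrightarrow> \<exists>x\<in>e. \<forall>f\<in>?E. x \<in> f \<longrightarrow> f = e"
      using tree_centre_exists[OF conn] by metis
    then show ?thesis using half_factorial_centre[OF two] by blast
  next
    case 4
    then have "diameter C \<le> 4" and cyc: "\<forall>k\<ge>3. contains_cycle C k \<longleftrightarrow> k = 4"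
      unfolding candy_graph_def by blast+
    have "contains_cycle C 4" "\<not> contains_cycle C 3" using cyc by simp_all
    then have "triangle_free ?E" "\<not> square_free ?E" "path6_free ?E"
      using contains_cycle_3_iff[OF simple] contains_cycle_4_iff[OF simple]
        diameter_le_4_iff[OF simple] \<open>diameter C \<le> 4\<close> by blast+
    then obtain a b where "\<forall>e\<in>?E. (a \<in> e) \<noteq> (b \<in> e)" using hub_pair_exists[OF conn] by metis
    then show ?thesis by (rule half_factorial_hub_pair[OF two])
  qed
qed

section \<open>Connected components\<close>

text \<open>Cutting out the stretch between two visits to the same vertex shortens the walk and
  keeps its ends. This bridges reachability, which is built from concatenated steps, and
  \<open>connected_graph\<close>, which asks for paths.\<close>

lemma walk_imp_path:
  assumes "is_walk G p"
  shows "\<exists>q. is_path G q \<and> hd q = hd p \<and> last q = last p"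
  using assms
proof (induction "length p" arbitrary: p rule: less_induct)
  case less
  show ?case
  proof (cases "distinct p")
    case True
    then show ?thesis using less.prems unfolding is_path_def by blast
  next
    case False
    then obtain xs ys zs y where p: "p = xs @ [y] @ ys @ [y] @ zs"
      using not_distinct_decomp by blast
    let ?q = "xs @ [y] @ zs"
    have "is_walk G ?q" "hd ?q = hd p" "last ?q = last p"
      using less.prems unfolding p is_walk_def
      by (auto simp: successively_append_iff successively_Cons hd_append)
    moreover have "length ?q < length p" unfolding p by simp
    ultimately show ?thesis using less.hyps[of ?q] by metis
  qed
qed

lemma reachable_imp_walk:
  assumes "(u, v) \<in> {(x, y). {x, y} \<in> edges G \<and> x \<in> verts G \<and> y \<in> verts G}\<^sup>*" "u \<in> verts G"
  shows "\<exists>p. is_walk G p \<and> hd p = u \<and> last p = v"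
  using assms
proof (induction rule: rtrancl_induct)
  case base
  then show ?case by (intro exI[of _ "[u]"]) (simp add: is_walk_def)
next
  case (step v w)
  then obtain p where "is_walk G p" "hd p = u" "last p = v" by blast
  with step.hyps(2) show ?case
    by (intro exI[of _ "p @ [w]"]) (auto simp: is_walk_def successively_append_iff)
qed

lemma walk_imp_reachable:
  assumes "is_walk H p" "edges H \<subseteq> E"
  shows "(hd p, last p) \<in> {(x, y). {x, y} \<in> E}\<^sup>*"
  using assms(1)
proof (induction p)
  case Nil
  then show ?case by (simp add: is_walk_def)
next
  case (Cons x p)
  show ?case
  proof (cases "p = []")
    case False
    with Cons.prems have "is_walk H p" "{x, hd p} \<in> E"
      using assms(2) by (auto simp: is_walk_def successively_Cons)
    with Cons.IH False show ?thesis by (auto intro: converse_rtrancl_into_rtrancl)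
  qed simp
qed

text \<open>Components are defined by maximality, so their existence takes a construction: the
  vertices reachable from \<open>v\<close> with all edges among them. A connected subgraph
  containing this one contains \<open>v\<close>, so all its vertices are reachable from
  \<open>v\<close> and it adds nothing.\<close>

lemma connected_component_of_reachable:
  assumes simple: "simple_graph G" and v: "v \<in> verts G"
  defines "K \<equiv> {(x, y). {x, y} \<in> edges G}\<^sup>* `` {v}"
  shows "connected_component_of \<lparr>verts = K, edges = {e \<in> edges G. e \<subseteq> K}\<rparr> G"
proof -
  let ?C = "\<lparr>verts = K, edges = {e \<in> edges G. e \<subseteq> K}\<rparr>"
  let ?r = "{(x, y). {x, y} \<in> edges G}"
  have "v \<in> K" unfolding K_def by blast
  have K_verts: "K \<subseteq> verts G"
  proof
    fix x assume "x \<in> K"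
    then have "(v, x) \<in> ?r\<^sup>*" unfolding K_def by simp
    then show "x \<in> verts G"
      by (cases rule: rtranclE) (use v simple in \<open>auto simp: simple_graph_def\<close>)
  qed
  have simpleC: "simple_graph ?C" using simple unfolding simple_graph_def by simp
  \<comment> \<open>The relation is restricted to \<open>K\<close> because a walk in
    \<open>?C\<close> must stay there; every intermediate vertex of a chain from \<open>v\<close> is
    itself reachable.\<close>
  have reach: "(v, y) \<in> {(x, y). {x, y} \<in> edges ?C \<and> x \<in> verts ?C \<and> y \<in> verts ?C}\<^sup>*"
    (is "_ \<in> ?s\<^sup>*") if "y \<in> K" for y
  proof -
    from that have "(v, y) \<in> ?r\<^sup>*" unfolding K_def by simp
    then show ?thesis
    proof (induction rule: rtrancl_induct)
      case (step y z)
      then have "y \<in> K" "z \<in> K" unfolding K_def by (auto intro: rtrancl_into_rtrancl)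
      with step have "(y, z) \<in> ?s" by simp
      with step.IH show ?case by (rule rtrancl_into_rtrancl)
    qed simp
  qed
  have "sym (?s\<^sup>*)" by (intro sym_rtrancl) (auto simp: sym_def insert_commute)
  have "connected_graph ?C" unfolding connected_graph_def
  proof (intro conjI ballI)
    show "simple_graph ?C" by (rule simpleC)
    show "verts ?C \<noteq> {}" using \<open>v \<in> K\<close> by auto
    fix x y assume xy: "x \<in> verts ?C" "y \<in> verts ?C"
    then have "(x, v) \<in> ?s\<^sup>*" "(v, y) \<in> ?s\<^sup>*"
      using reach \<open>sym (?s\<^sup>*)\<close> by (auto dest: symD)
    then have "(x, y) \<in> ?s\<^sup>*" by (rule rtrancl_trans)
    then obtain p where "is_walk ?C p" "hd p = x" "last p = y"
      using reachable_imp_walk[of x y ?C] xy(1) by blast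
    then show "\<exists>p. is_path ?C p \<and> hd p = x \<and> last p = y" using walk_imp_path by blast
  qed
  moreover have "subgraph ?C G" unfolding subgraph_def using simpleC K_verts by auto
  moreover have "H = ?C" if H: "subgraph H G" "connected_graph H" "subgraph ?C H" for H
  proof -
    have EH: "edges H \<subseteq> edges G" and simpleH: "simple_graph H" using H(1) unfolding subgraph_def by auto
    have CH: "K \<subseteq> verts H" "edges ?C \<subseteq> edges H" using H(3) unfolding subgraph_def by auto
    have "verts H \<subseteq> K"
    proof
      fix x assume "x \<in> verts H"
      then obtain p where "is_path H p" "hd p = v" "last p = x"
        using H(2) CH \<open>v \<in> K\<close> unfolding connected_graph_def by blast
      then show "x \<in> K" using walk_imp_reachable[OF _ EH, of p] unfolding is_path_def K_def by auto
    qed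
    with CH have vs: "verts H = K" by blast
    have "edges H = edges ?C"
    proof
      show "edges H \<subseteq> edges ?C" using EH simpleH vs unfolding simple_graph_def by auto
    qed (rule CH)
    with vs show ?thesis by simp
  qed
  ultimately show ?thesis unfolding connected_component_of_def by blast
qed

section \<open>Splitting the quarks along the components\<close>

theorem theorem5p7:
  fixes S :: "nat set set"
  assumes "boolean_sublattice S"
    and "factorizable S"
    and "\<forall>A\<in>quarks S. card A \<le> 2"
  shows "(HFS S \<longleftrightarrow>
            (\<forall>C. connected_component_of C (pairing_graph S) \<longrightarrow>
                 HFS (generated_sublattice (edges C)))) \<and>
         (HFS S \<longleftrightarrow>
            (\<forall>C. connected_component_of C (pairing_graph S) \<longrightarrow>
                 cycle_graph 3 C \<or> cycle_graph 5 C \<or>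
                 (is_tree C \<and> diameter C \<le> 4) \<or> candy_graph C))"
proof -
  let ?G = "pairing_graph S" and ?Q = "quarks S"
  have quark: "A \<subseteq> {1..}" "finite A" "A \<noteq> {}" if "A \<in> ?Q" for A
    using that assms(1) unfolding quarks_def boolean_sublattice_def Fpow_def by auto
  have edges_G: "edges ?G = {A \<in> ?Q. card A = 2}"
    unfolding pairing_graph_def by (auto simp: card_2_iff)
  have simple: "simple_graph ?G"
    using quark(1) unfolding simple_graph_def edges_G by (auto simp: pairing_graph_def)
  have comp: "connected_graph C" "edges C \<subseteq> ?Q" "edges C \<subseteq> Fpow {1..}" "\<forall>e\<in>edges C. card e = 2"
    if "connected_component_of C ?G" for C
  proof -
    show "connected_graph C" "edges C \<subseteq> ?Q" "\<forall>e\<in>edges C. card e = 2"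
      using that unfolding connected_component_of_def subgraph_def edges_G by auto
    then show "edges C \<subseteq> Fpow {1..}" using quark unfolding Fpow_def by blast
  qed
  have hfs: "HFS S \<longleftrightarrow> half_factorial ?Q"
    using HFS_iff_half_factorial_quarks[OF assms(1,2)] .
  have gen: "HFS (generated_sublattice (edges C)) \<longleftrightarrow> half_factorial (edges C)"
    if "connected_component_of C ?G" for C
    using HFS_generated_sublattice_iff[OF comp(3,4)[OF that]] .
  have shape: "half_factorial (edges C) \<longleftrightarrow> cycle_graph 3 C \<or> cycle_graph 5 C \<or>
      (is_tree C \<and> diameter C \<le> 4) \<or> candy_graph C"
    if "connected_component_of C ?G" for C
    using connected_half_factorial_imp_shape connected_shape_imp_half_factorial comp(1)[OF that] by blast
  \<comment> \<open>All three conditions of the theorem are compared through this equivalence. Left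
    to right is restriction to a subfamily; the converse reassembles the components.\<close>
  have "half_factorial ?Q \<longleftrightarrow> (\<forall>C. connected_component_of C ?G \<longrightarrow> half_factorial (edges C))"
  proof
    assume "half_factorial ?Q"
    then show "\<forall>C. connected_component_of C ?G \<longrightarrow> half_factorial (edges C)"
      using half_factorial_subset comp(2) by blast
  next
    assume *: "\<forall>C. connected_component_of C ?G \<longrightarrow> half_factorial (edges C)"
    let ?r = "{(x, y). {x, y} \<in> edges ?G}"
    have "sym (?r\<^sup>*)" by (intro sym_rtrancl) (auto simp: sym_def insert_commute)
    \<comment> \<open>The label of a point is its reachability class, defined for every natural
      number; a number without edges, such as 0, is labelled by its own singleton.\<close>
    define k where "k x = ?r\<^sup>* `` {x}" for x
    have refl: "x \<in> k x" for x unfolding k_def by blast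
    have k_eq: "k x = k y" if "y \<in> k x" for x y
      using that \<open>sym (?r\<^sup>*)\<close> unfolding k_def by (auto dest: symD intro: rtrancl_trans)
    have cases: "card A = 1 \<or> A \<in> edges ?G" if "A \<in> ?Q" for A
    proof -
      have "card A \<noteq> 0" using quark(2,3)[OF that] by simp
      moreover have "card A \<le> 2" using assms(3) that by blast
      ultimately show ?thesis using that unfolding edges_G by fastforce
    qed
    show "half_factorial ?Q"
    proof (rule half_factorial_partition[where k = k])
      show "{} \<notin> ?Q" using quark(3) by blast
      show const: "k x = k y" if "e \<in> ?Q" "x \<in> e" "y \<in> e" for e x y
      proof (cases "x = y")
        case False
        with cases[OF that(1)] that(2,3) have "e \<in> edges ?G" by (metis card_1_singletonE singletonD)
        moreover have "e = {x, y}"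
          using that(2,3) False \<open>e \<in> edges ?G\<close> unfolding edges_G by (auto simp: card_2_iff)
        ultimately have "y \<in> k x" unfolding k_def by auto
        then show ?thesis by (rule k_eq)
      qed simp
      fix c
      let ?P = "{e \<in> ?Q. k ` e = {c}}"
      show "half_factorial ?P"
      proof (cases "?P = {}")
        case True
        then show ?thesis unfolding True by (simp add: half_factorial_def)
      next
        case False
        then obtain e where e: "e \<in> ?Q" "k ` e = {c}" by blast
        then obtain v where v: "v \<in> e" using quark(3)[OF e(1)] by blast
        with e(2) have c: "c = k v" by (metis imageI singletonD)
        show ?thesis
        \<comment> \<open>A class consisting of edges only lies in one component. A class with a
          one-element quark \<open>{a}\<close> turns out to consist of that quark alone.\<close>
        proof (cases "?P \<subseteq> edges ?G")
          case True
          have "v \<in> {1..}" using quark(1)[OF e(1)] v by blast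
          then have "connected_component_of \<lparr>verts = k v, edges = {e \<in> edges ?G. e \<subseteq> k v}\<rparr> ?G"
            unfolding k_def by (intro connected_component_of_reachable[OF simple]) (simp add: pairing_graph_def)
          with * have "half_factorial {e \<in> edges ?G. e \<subseteq> k v}" by fastforce
          moreover have "?P \<subseteq> {e \<in> edges ?G. e \<subseteq> k v}"
          proof
            fix f assume f: "f \<in> ?P"
            then have "k x = k v" if "x \<in> f" for x
              using imageI[OF that, of k] c by simp
            then have "f \<subseteq> k v" using refl by blast
            with f True show "f \<in> {e \<in> edges ?G. e \<subseteq> k v}" by blast
          qed
          ultimately show ?thesis by (rule half_factorial_subset)
        next
          case False
          then obtain A where A: "A \<in> ?Q" "k ` A = {c}" "A \<notin> edges ?G" by blast
          with cases[OF A(1)] obtain a where a: "A = {a}" by (metis card_1_singletonE)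
          have isolated: "{a, b} \<notin> edges ?G" for b
          proof
            assume "{a, b} \<in> edges ?G"
            then have "{a, b} \<in> ?Q" "card {a, b} = 2" unfolding edges_G by blast+
            then have "{a} \<subset> {a, b}" by (cases "a = b") auto
            moreover have "{a} \<in> S" using A(1) a unfolding quarks_def by blast
            ultimately show False using \<open>{a, b} \<in> ?Q\<close> unfolding quarks_def by blast
          qed
          have "k a = {a}"
          proof -
            have "x = a" if "(a, x) \<in> ?r\<^sup>*" for x
              using that by (cases rule: converse_rtranclE) (use isolated in auto)
            then show ?thesis using refl[of a] unfolding k_def by blast
          qed
          then have c': "c = {a}" using A(2) a by simp
          have "?P \<subseteq> {{a}}"
          proof
            fix f assume f: "f \<in> ?P"
            have "x = a" if "x \<in> f" for x
              using imageI[OF that, of k] f c' refl[of x] by simp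
            moreover have "f \<noteq> {}" using f quark(3) by blast
            ultimately show "f \<in> {{a}}" by blast
          qed
          \<comment> \<open>The only subfamilies are \<open>{}\<close> and \<open>{{a}}\<close>,
            told apart by their unions.\<close>
          moreover have "half_factorial {{a}}" unfolding half_factorial_def
            by (auto simp: subset_singleton_iff)
          ultimately show ?thesis using half_factorial_subset by blast
        qed
      qed
    qed
  qed
  moreover have "(\<forall>C. connected_component_of C ?G \<longrightarrow> HFS (generated_sublattice (edges C))) \<longleftrightarrow>
      (\<forall>C. connected_component_of C ?G \<longrightarrow> half_factorial (edges C))"
    using gen by blast
  moreover have "(\<forall>C. connected_component_of C ?G \<longrightarrow> cycle_graph 3 C \<or> cycle_graph 5 C \<or>
        (is_tree C \<and> diameter C \<le> 4) \<or> candy_graph C) \<longleftrightarrow>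
      (\<forall>C. connected_component_of C ?G \<longrightarrow> half_factorial (edges C))"
    using shape by blast
  ultimately show ?thesis using hfs by (simp only:)
qed

end
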